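(* Let $\mathfrak{g}=\mathfrak{sl}_2$ or $\mathfrak{sol}_2$. If $\Gamma=(\mathsf{V},\mathsf{E})$ is a finite, simplicial graph, and $V_\theta$ is a non-zero finite-dimensional $\mathfrak{g}$-module with structure map $\theta\colon\mathfrak{g}\to\mathfrak{gl}(V)$, then $$\mathcal{R}^1_1(A^\bullet_\Gamma,\theta)=\bigcup_{\substack{\mathsf{W}\subseteq\mathsf{V}\\c(\mathsf{W})=1}}P_{\mathsf{W}}\cup\bigcup_{\substack{\mathsf{W}\subseteq\mathsf{V}\\c(\mathsf{W})>1}}S_{\mathsf{W}}.$$
   Context: Everything is over $\mathbb{C}$. $\mathfrak{sol}_2$ is the standard Borel subalgebra of $\mathfrak{sl}_2$. For a finite simplicial graph $\Gamma=(\mathsf{V},\mathsf{E})$, $A^\bullet_\Gamma=H^\bullet(\pi_\Gamma,\mathbb{C})$ is the cohomology algebra of the right-angled Artin group $\pi_\Gamma$ (generators $v\in\mathsf{V}$, relations $vw=wv$ for $\{v,w\}\in\mathsf{E}$), endowed with zero differential. It is the quotient of the exterior algebra on degree $1$ generators $v^*$, $v\in\mathsf{V}$, by the ideal generated by the monomials $v^*w^*$ with $\{v,w\}\notin\mathsf{E}$; thus $A^1_\Gamma=\mathbb{C}^{\mathsf{V}}$. For a commutative differential graded algebra $A$, $A\otimes\mathfrak{g}$ has bracket $[\alpha\otimes x,\beta\otimes y]=\alpha\beta\otimes[x,y]$ and differential $\partial(\alpha\otimes x)=d\alpha\otimes x$; $\mathcal{F}(A,\mathfrak{g})=\{\omega\in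 A^1\otimes\mathfrak{g}\mid\partial\omega+\frac12[\omega,\omega]=0\}$. For $\omega=\sum_i\eta_i\otimes g_i\in\mathcal{F}(A,\mathfrak{g})$, put $d_\omega(\alpha\otimes v)=d\alpha\otimes v+\sum_i\eta_i\alpha\otimes\theta(g_i)v$ on $A\otimes V$, and $\mathcal{R}^1_1(A,\theta)=\{\omega\in\mathcal{F}(A,\mathfrak{g})\mid H^1(A\otimes V,d_\omega)\ne0\}$. Elements $\omega\in\mathbb{C}^{\mathsf{V}}\otimes\mathfrak{g}$ are written as tuples $(\omega_v)_{v\in\mathsf{V}}$, $\omega_v\in\mathfrak{g}$. For $\mathsf{W}\subseteq\mathsf{V}$, let $\Gamma_{\mathsf{W}}$ be the induced subgraph, $c=c(\mathsf{W})$ its number of connected components, $\mathsf{W}_1,\dots,\mathsf{W}_c$ their vertex sets, $\overline{\mathsf{W}}=\mathsf{V}\setminus\mathsf{W}$. Put $$S_{\mathsf{W}}=\{\omega\in\mathbb{C}^{\mathsf{V}}\otimes\mathfrak{g}\mid\omega_v=0\text{ for }v\in\overline{\mathsf{W}},\ \operatorname{rank}\{\omega_v\}_{v\in\mathsf{W}_i}\le1\text{ for }1\le i\le c\}$$ (rank = dimension of the linear span), and let $P_{\mathsf{W}}$ be the set of $\omega\in\mathbb{C}^{\mathsf{V}}\otimes\mathfrak{g}$ with $\omega_v=0$ for $v\in\overline{\mathsf{W}}$ and $\omega_v=\lambda_vg_{\mathsf{W}}$ for $v\in\mathsf{W}$, where $\lambda_v\in\mathbb{C}$ and $g_{\mathsf{W}}\in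 V(\det\circ\theta)=\{g\in\mathfrak{g}\mid\det(\theta(g))=0\}$ is independent of $v$. *)

theory Defs
  imports
    "HOL-Analysis.Analysis"
    "HOL-Algebra.QuotRing"
    "HOL-Algebra.Module"
    "HOL-Library.Poly_Mapping"
    "Jordan_Normal_Form.Determinant"
begin

definition simplicial_graph :: "'v set \<Rightarrow> 'v set set \<Rightarrow> bool" where
  "simplicial_graph V E \<longleftrightarrow> (\<forall>e\<in>E. \<exists>v\<in>V. \<exists>w\<in>V. v \<noteq> w \<and> e = {v, w})"

definition induced_adj :: "'v set set \<Rightarrow> 'v set \<Rightarrow> ('v \<times> 'v) set" where
  "induced_adj E W = {(v, w). v \<in> W \<and> w \<in> W \<and> {v, w} \<in> E}"

text \<open>The vertex sets of the connected components of the subgraph induced on \<open>W\<close>. The adjacency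
  relation lives on \<open>W\<close>, so the classes of elements of \<open>W\<close> stay inside \<open>W\<close>.\<close>

definition components :: "'v set set \<Rightarrow> 'v set \<Rightarrow> 'v set set" where
  "components E W = W // (induced_adj E W)\<^sup>*"

definition num_components :: "'v set set \<Rightarrow> 'v set \<Rightarrow> nat" where
  "num_components E W = card (components E W)"

record 'a graded_algebra = "(complex, 'a) module" +
  deg :: "nat \<Rightarrow> 'a set"

record 'a cdga = "'a graded_algebra" +
  diff :: "'a \<Rightarrow> 'a"

definition quot_algebra ::
  "('a, 'x) graded_algebra_scheme \<Rightarrow> 'a set \<Rightarrow> 'a set graded_algebra" where
  "quot_algebra A I =
    \<lparr>carrier = carrier (A Quot I), mult = mult (A Quot I), one = one (A Quot I),
     zero = zero (A Quot I), add = add (A Quot I),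
     smult = (\<lambda>c X. \<Union>x\<in>X. I +>\<^bsub>A\<^esub> (c \<odot>\<^bsub>A\<^esub> x)),
     deg = (\<lambda>i. (\<lambda>x. I +>\<^bsub>A\<^esub> x) ` deg A i)\<rparr>"

text \<open>Words form the free monoid, written additively because \<^type>\<open>poly_mapping\<close> turns an additive
  monoid into its monoid algebra; the monoid algebra of the free monoid is the tensor algebra.\<close>

datatype 'v word = Word (letters: "'v list")

instantiation word :: (type) monoid_add
begin

definition zero_word :: "'a word" where
  "zero_word = Word []"

definition plus_word :: "'a word \<Rightarrow> 'a word \<Rightarrow> 'a word" where
  "plus_word u w = Word (letters u @ letters w)"

instance
  by standard (simp_all add: zero_word_def plus_word_def)

end

definition tensor_algebra :: "'v set \<Rightarrow> ('v word \<Rightarrow>\<^sub>0 complex) graded_algebra" where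
  "tensor_algebra V =
    \<lparr>carrier = {p. \<forall>w\<in>Poly_Mapping.keys p. set (letters w) \<subseteq> V},
     mult = (*), one = 1, zero = 0, add = (+),
     smult = (\<lambda>c p. Poly_Mapping.single 0 c * p),
     deg = (\<lambda>i. {p. \<forall>w\<in>Poly_Mapping.keys p. set (letters w) \<subseteq> V \<and> length (letters w) = i})\<rparr>"

definition exterior_ideal :: "'v set \<Rightarrow> ('v word \<Rightarrow>\<^sub>0 complex) set" where
  "exterior_ideal V =
    Idl\<^bsub>tensor_algebra V\<^esub> {x \<otimes>\<^bsub>tensor_algebra V\<^esub> x | x. x \<in> deg (tensor_algebra V) 1}"

definition exterior_algebra :: "'v set \<Rightarrow> ('v word \<Rightarrow>\<^sub>0 complex) set graded_algebra" where
  "exterior_algebra V = quot_algebra (tensor_algebra V) (exterior_ideal V)"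

definition exterior_gen :: "'v set \<Rightarrow> 'v \<Rightarrow> ('v word \<Rightarrow>\<^sub>0 complex) set" where
  "exterior_gen V v = exterior_ideal V +>\<^bsub>tensor_algebra V\<^esub> Poly_Mapping.single (Word [v]) 1"

text \<open>The cohomology algebra of the right-angled Artin group of the graph \<open>(V, E)\<close>, given by its
  presentation as a quotient of the exterior algebra and equipped with the zero differential.\<close>

type_synonym 'v raag_elem = "('v word \<Rightarrow>\<^sub>0 complex) set set"

definition raag_ideal :: "'v set \<Rightarrow> 'v set set \<Rightarrow> 'v raag_elem" where
  "raag_ideal V E =
    Idl\<^bsub>exterior_algebra V\<^esub>
      {exterior_gen V v \<otimes>\<^bsub>exterior_algebra V\<^esub> exterior_gen V w | v w.
        v \<in> V \<and> w \<in> V \<and> {v, w} \<notin> E}"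

definition raag_algebra :: "'v set \<Rightarrow> 'v set set \<Rightarrow> 'v raag_elem cdga" where
  "raag_algebra V E =
    graded_algebra.extend (quot_algebra (exterior_algebra V) (raag_ideal V E))
      (cdga.fields (\<lambda>_. zero (quot_algebra (exterior_algebra V) (raag_ideal V E))))"

definition raag_gen :: "'v set \<Rightarrow> 'v set set \<Rightarrow> 'v \<Rightarrow> 'v raag_elem" where
  "raag_gen V E v = raag_ideal V E +>\<^bsub>exterior_algebra V\<^esub> exterior_gen V v"

text \<open>A complex vector space here is a subspace of an ambient abelian group, with scalar
  multiplication \<open>scale\<close>.\<close>

record 'b cspace =
  vectors :: "'b set"
  scale :: "complex \<Rightarrow> 'b \<Rightarrow> 'b"

record 'g lie_algebra = "'g cspace" +
  bracket :: "'g \<Rightarrow> 'g \<Rightarrow> 'g"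

definition sl2 :: "(complex^2^2) lie_algebra" where
  "sl2 = \<lparr>vectors = {x. trace x = 0},
          scale = (\<lambda>c. map_matrix ((*) c)),
          bracket = (\<lambda>x y. x ** y - y ** x)\<rparr>"

definition sol2 :: "(complex^2^2) lie_algebra" where
  "sol2 = sl2\<lparr>vectors := {x. trace x = 0 \<and> x $ 2 $ 1 = 0}\<rparr>"

definition full_space :: "(complex \<Rightarrow> 'v \<Rightarrow> 'v) \<Rightarrow> 'v cspace" where
  "full_space s = \<lparr>vectors = UNIV, scale = s\<rparr>"

definition lie_module ::
  "'g::ab_group_add lie_algebra \<Rightarrow> (complex \<Rightarrow> 'v \<Rightarrow> 'v) \<Rightarrow> ('g \<Rightarrow> 'v \<Rightarrow> 'v::ab_group_add) \<Rightarrow> bool" where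
  "lie_module \<gg> s \<theta> \<longleftrightarrow>
    (\<forall>x\<in>vectors \<gg>. Vector_Spaces.linear s s (\<theta> x)) \<and>
    (\<forall>x\<in>vectors \<gg>. \<forall>y\<in>vectors \<gg>. \<forall>v. \<theta> (x + y) v = \<theta> x v + \<theta> y v) \<and>
    (\<forall>c. \<forall>x\<in>vectors \<gg>. \<forall>v. \<theta> (scale \<gg> c x) v = s c (\<theta> x v)) \<and>
    (\<forall>x\<in>vectors \<gg>. \<forall>y\<in>vectors \<gg>. \<forall>v.
       \<theta> (bracket \<gg> x y) v = \<theta> x (\<theta> y v) - \<theta> y (\<theta> x v))"

text \<open>Determinant of an endomorphism of a finite-dimensional space: the determinant of its matrix in
  some ordered basis.\<close>

definition endo_det :: "(complex \<Rightarrow> 'v::ab_group_add \<Rightarrow> 'v) \<Rightarrow> ('v \<Rightarrow> 'v) \<Rightarrow> complex" where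
  "endo_det s f =
    (let bs = (SOME bs. distinct bs \<and> \<not> Modules.module.dependent s (set bs) \<and>
                        Modules.module.span s (set bs) = UNIV)
     in Determinant.det (Matrix.mat (length bs) (length bs)
          (\<lambda>(i, j). Modules.module.representation s (set bs) (f (bs ! j)) (bs ! i))))"

text \<open>Over a field, \<open>A \<otimes> M\<close> embeds into the linear dual of the space of bilinear forms on
  \<open>A \<times> M\<close> by \<open>a \<otimes> x \<mapsto> (\<beta> \<mapsto> \<beta>(a, x))\<close>, and is identified with its image: the finite sums of pure
  tensors. Elements are made \<open>0\<close> at arguments \<open>\<beta>\<close> that are not bilinear, so that equality of elements
  is equality of functions.\<close>

type_synonym ('a, 'b) tensor = "('a \<Rightarrow> 'b \<Rightarrow> complex) \<Rightarrow> complex"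

definition bilinear_forms ::
  "(complex, 'a, 'x) module_scheme \<Rightarrow> ('b::ab_group_add, 'y) cspace_scheme \<Rightarrow>
   ('a \<Rightarrow> 'b \<Rightarrow> complex) set" where
  "bilinear_forms A M = {\<beta>.
    (\<forall>a\<in>carrier A. \<forall>b\<in>carrier A. \<forall>x\<in>vectors M. \<beta> (a \<oplus>\<^bsub>A\<^esub> b) x = \<beta> a x + \<beta> b x) \<and>
    (\<forall>a\<in>carrier A. \<forall>x\<in>vectors M. \<forall>y\<in>vectors M. \<beta> a (x + y) = \<beta> a x + \<beta> a y) \<and>
    (\<forall>c. \<forall>a\<in>carrier A. \<forall>x\<in>vectors M. \<beta> (c \<odot>\<^bsub>A\<^esub> a) x = c * \<beta> a x) \<and>
    (\<forall>c. \<forall>a\<in>carrier A. \<forall>x\<in>vectors M. \<beta> a (scale M c x) = c * \<beta> a x)}"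

text \<open>The element \<open>\<Sum>i\<in>I. a i \<otimes> x i\<close>.\<close>

definition tensor_sum ::
  "(complex, 'a, 'x) module_scheme \<Rightarrow> ('b::ab_group_add, 'y) cspace_scheme \<Rightarrow>
   'i set \<Rightarrow> ('i \<Rightarrow> 'a) \<Rightarrow> ('i \<Rightarrow> 'b) \<Rightarrow> ('a, 'b) tensor" where
  "tensor_sum A M I a x = (\<lambda>\<beta>. if \<beta> \<in> bilinear_forms A M then \<Sum>i\<in>I. \<beta> (a i) (x i) else 0)"

definition tensors ::
  "('a, 'x) graded_algebra_scheme \<Rightarrow> nat \<Rightarrow> ('b::ab_group_add, 'y) cspace_scheme \<Rightarrow>
   ('a, 'b) tensor set" where
  "tensors A i M =
    {tensor_sum A M {..<n} a x | (n::nat) a x. \<forall>j<n. a j \<in> deg A i \<and> x j \<in> vectors M}"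

text \<open>The maps below are the transposes of operations on bilinear forms; on pure tensors they are
  \<open>a \<otimes> x \<mapsto> da \<otimes> x\<close>, \<open>(a \<otimes> x, b \<otimes> y) \<mapsto> ab \<otimes> [x, y]\<close>, and, for \<open>\<omega> = \<Sum>i. \<eta>\<^sub>i \<otimes> g\<^sub>i\<close>,
  \<open>a \<otimes> v \<mapsto> da \<otimes> v + (\<Sum>i. \<eta>\<^sub>i a \<otimes> \<theta>(g\<^sub>i)v)\<close>.\<close>

definition tensor_diff ::
  "('a, 'x) cdga_scheme \<Rightarrow> ('b::ab_group_add, 'y) cspace_scheme \<Rightarrow>
   ('a, 'b) tensor \<Rightarrow> ('a, 'b) tensor" where
  "tensor_diff A M t =
    (\<lambda>\<beta>. if \<beta> \<in> bilinear_forms A M then t (\<lambda>a x. \<beta> (diff A a) x) else 0)"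

definition tensor_bracket ::
  "('a, 'x) cdga_scheme \<Rightarrow> 'g::ab_group_add lie_algebra \<Rightarrow>
   ('a, 'g) tensor \<Rightarrow> ('a, 'g) tensor \<Rightarrow> ('a, 'g) tensor" where
  "tensor_bracket A \<gg> s t =
    (\<lambda>\<beta>. if \<beta> \<in> bilinear_forms A \<gg>
         then s (\<lambda>a x. t (\<lambda>b y. \<beta> (a \<otimes>\<^bsub>A\<^esub> b) (bracket \<gg> x y))) else 0)"

definition flat_connections ::
  "('a, 'x) cdga_scheme \<Rightarrow> 'g::ab_group_add lie_algebra \<Rightarrow> ('a, 'g) tensor set" where
  "flat_connections A \<gg> =
    {\<omega> \<in> tensors A 1 \<gg>.
      (\<lambda>\<beta>. tensor_diff A \<gg> \<omega> \<beta> + 1/2 * tensor_bracket A \<gg> \<omega> \<omega> \<beta>) = (\<lambda>_. 0)}"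

definition twisted_diff ::
  "('a, 'x) cdga_scheme \<Rightarrow> (complex \<Rightarrow> 'v \<Rightarrow> 'v) \<Rightarrow> ('g \<Rightarrow> 'v \<Rightarrow> 'v::ab_group_add) \<Rightarrow>
   ('a, 'g) tensor \<Rightarrow> ('a, 'v) tensor \<Rightarrow> ('a, 'v) tensor" where
  "twisted_diff A s \<theta> \<omega> t =
    (\<lambda>\<beta>. if \<beta> \<in> bilinear_forms A (full_space s)
         then t (\<lambda>a v. \<beta> (diff A a) v) + \<omega> (\<lambda>\<eta> g. t (\<lambda>a v. \<beta> (\<eta> \<otimes>\<^bsub>A\<^esub> a) (\<theta> g v)))
         else 0)"

definition cocycles1 ::
  "('a, 'x) cdga_scheme \<Rightarrow> (complex \<Rightarrow> 'v \<Rightarrow> 'v) \<Rightarrow> ('g \<Rightarrow> 'v \<Rightarrow> 'v::ab_group_add) \<Rightarrow>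
   ('a, 'g) tensor \<Rightarrow> ('a, 'v) tensor set" where
  "cocycles1 A s \<theta> \<omega> = {t \<in> tensors A 1 (full_space s). twisted_diff A s \<theta> \<omega> t = (\<lambda>_. 0)}"

definition coboundaries1 ::
  "('a, 'x) cdga_scheme \<Rightarrow> (complex \<Rightarrow> 'v \<Rightarrow> 'v) \<Rightarrow> ('g \<Rightarrow> 'v \<Rightarrow> 'v::ab_group_add) \<Rightarrow>
   ('a, 'g) tensor \<Rightarrow> ('a, 'v) tensor set" where
  "coboundaries1 A s \<theta> \<omega> = twisted_diff A s \<theta> \<omega> ` tensors A 0 (full_space s)"

definition cohomology1 ::
  "('a, 'x) cdga_scheme \<Rightarrow> (complex \<Rightarrow> 'v \<Rightarrow> 'v) \<Rightarrow> ('g \<Rightarrow> 'v \<Rightarrow> 'v::ab_group_add) \<Rightarrow>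
   ('a, 'g) tensor \<Rightarrow> ('a, 'v) tensor set set" where
  "cohomology1 A s \<theta> \<omega> =
    cocycles1 A s \<theta> \<omega> //
      {(t, u). t \<in> cocycles1 A s \<theta> \<omega> \<and> u \<in> cocycles1 A s \<theta> \<omega> \<and>
               (\<lambda>\<beta>. t \<beta> - u \<beta>) \<in> coboundaries1 A s \<theta> \<omega>}"

text \<open>The zero class is the set of coboundaries, so \<open>{coboundaries1 A s \<theta> \<omega>}\<close> is the zero space.\<close>

definition resonance_variety ::
  "('a, 'x) cdga_scheme \<Rightarrow> 'g::ab_group_add lie_algebra \<Rightarrow> (complex \<Rightarrow> 'v \<Rightarrow> 'v) \<Rightarrow>
   ('g \<Rightarrow> 'v \<Rightarrow> 'v::ab_group_add) \<Rightarrow> ('a, 'g) tensor set" where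
  "resonance_variety A \<gg> s \<theta> =
    {\<omega> \<in> flat_connections A \<gg>. cohomology1 A s \<theta> \<omega> \<noteq> {coboundaries1 A s \<theta> \<omega>}}"

text \<open>The element \<open>\<Sum>v\<in>V. v\<^sup>* \<otimes> \<omega> v\<close> of \<open>A\<^sup>1 \<otimes> \<gg>\<close> corresponding to a tuple \<open>\<omega>\<close>; the values of
  \<open>\<omega>\<close> outside \<open>V\<close> are irrelevant.\<close>

definition tuple_tensor ::
  "'v set \<Rightarrow> 'v set set \<Rightarrow> 'g::ab_group_add lie_algebra \<Rightarrow> ('v \<Rightarrow> 'g) \<Rightarrow>
   ('v raag_elem, 'g) tensor" where
  "tuple_tensor V E \<gg> \<omega> = tensor_sum (raag_algebra V E) \<gg> V (raag_gen V E) \<omega>"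

definition S_set ::
  "'v set \<Rightarrow> 'v set set \<Rightarrow> 'g::ab_group_add lie_algebra \<Rightarrow> 'v set \<Rightarrow>
   ('v raag_elem, 'g) tensor set" where
  "S_set V E \<gg> W = tuple_tensor V E \<gg> ` {\<omega>.
    (\<forall>v\<in>V. \<omega> v \<in> vectors \<gg>) \<and> (\<forall>v\<in>V - W. \<omega> v = 0) \<and>
    (\<forall>C\<in>components E W.
       vector_space.dim (scale \<gg>) (Modules.module.span (scale \<gg>) (\<omega> ` C)) \<le> 1)}"

definition P_set ::
  "'v set \<Rightarrow> 'v set set \<Rightarrow> 'g::ab_group_add lie_algebra \<Rightarrow> (complex \<Rightarrow> 'u \<Rightarrow> 'u) \<Rightarrow>
   ('g \<Rightarrow> 'u \<Rightarrow> 'u::ab_group_add) \<Rightarrow> 'v set \<Rightarrow> ('v raag_elem, 'g) tensor set" where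
  "P_set V E \<gg> s \<theta> W = tuple_tensor V E \<gg> ` {\<omega>.
    (\<forall>v\<in>V - W. \<omega> v = 0) \<and>
    (\<exists>g\<in>{g \<in> vectors \<gg>. endo_det s (\<theta> g) = 0}. \<exists>c :: 'v \<Rightarrow> complex.
       \<forall>v\<in>W. \<omega> v = scale \<gg> (c v) g)}"

end

theory Submission
  imports Defs
begin

text \<open>Write an element of \<open>A\<^sup>1 \<otimes> \<gg>\<close> as a tuple \<open>\<omega>\<close> of vectors indexed by the vertices. Only
  \<open>A\<^sup>0\<close>, \<open>A\<^sup>1\<close> and \<open>A\<^sup>2\<close> enter, and \<open>A\<^sup>2\<close> has one basis vector for each edge.
  Hence everything is read off edge by edge: \<open>\<omega>\<close> is flat iff \<open>[\<omega>\<^sub>v, \<omega>\<^sub>w] = 0\<close> on all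
  edges (\<open>flat_connection_iff\<close>), a tuple \<open>u\<close> of module elements is a 1-cocycle iff
  \<open>\<theta>(\<omega>\<^sub>v) u\<^sub>w = \<theta>(\<omega>\<^sub>w) u\<^sub>v\<close> on all edges, and the coboundaries are the tuples
  \<open>v \<mapsto> \<theta>(\<omega>\<^sub>v) x\<close>. Membership in the resonance variety becomes the elementary condition
  \<open>resonance_iff\<close>.

  In \<open>sl\<^sub>2\<close>, and so in \<open>sol\<^sub>2\<close>, two commuting elements are proportional as soon as the first
  is non-zero. A flat tuple is therefore of the form \<open>\<omega>\<^sub>v = c\<^sub>v g\<close> on each connected component of
  its support. For every set \<open>W\<close> of vertices outside which \<open>\<omega>\<close> vanishes and every component \<open>C\<close>
  of \<open>W\<close> on which \<open>\<omega>\<^sub>v = c\<^sub>v g\<close> with \<open>c\<close> not identically zero, each \<open>x\<close> gives the cocycle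
  \<open>c\<^sub>v x\<close> supported on \<open>C\<close>, and a primitive \<open>z\<close> of it has to satisfy \<open>x = \<theta>(g) z\<close>. (Where \<open>\<omega>\<close>
  vanishes on \<open>C\<close>, take \<open>g = 0\<close> and \<open>c = 1\<close>.)

  If \<open>W\<close> is connected and \<open>\<theta>(g)\<close> is singular, some \<open>x\<close> lies outside the image of \<open>\<theta>(g)\<close>, so the
  cohomology is non-zero (\<open>P_subset\<close>). If \<open>W\<close> has two components with vectors \<open>g\<close> and \<open>h\<close> and
  the cohomology were zero, then \<open>\<theta>(g)\<close> would be surjective, hence injective, while a primitive of a cocycle
  supported on the second component is killed by \<open>\<theta>(g)\<close> and so vanishes; this contradicts the
  existence of a non-zero cocycle there (\<open>S_subset\<close>).

  Conversely (\<open>resonance_subset\<close>), let \<open>W\<close> be the support of \<open>\<omega>\<close> in the resonance variety. Only a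
  connected non-empty \<open>W\<close> with \<open>\<theta>(g)\<close> invertible needs an argument. In that case every cocycle agrees on
  \<open>W\<close> with a coboundary and vanishes at the vertices adjacent to \<open>W\<close>
  (\<open>cocycle_coboundary_if_invertible\<close>), so a non-trivial class forces a vertex \<open>v\<close> outside \<open>W\<close>
  without a neighbour in \<open>W\<close>. Then \<open>W \<union> {v}\<close> is disconnected and \<open>\<omega>\<close>, being zero at \<open>v\<close>,
  belongs to the corresponding \<open>S\<close>-stratum.

  The groundwork is the presentation of \<open>A\<close>: a quotient of a quotient of the tensor algebra. Upper
  bounds on \<open>A\<^sup>2\<close> come from the relations; the independence of the generators and of the edge
  products comes from one explicit ideal of the tensor algebra (\<open>edge_symmetric\<close>) that contains all
  relations. As tensors are functionals on bilinear forms, independence is used in the form of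
  bilinear forms that read off single coefficients (\<open>bilinear_form_of_coeff\<close>).\<close>

section \<open>The tensor algebra\<close>

text \<open>The factorizations \<open>l = u w\<close> of a word in the free monoid are its cuts into a prefix and a
  suffix, so products in the monoid algebra are given by a finite Cauchy formula. This is what makes
  coefficients at words of length at most two computable.\<close>

lemma lookup_mult_word:
  fixes p q :: "'v word \<Rightarrow>\<^sub>0 'c::semiring_0"
  shows "Poly_Mapping.lookup (p * q) (Word l) =
    (\<Sum>i\<le>length l. Poly_Mapping.lookup p (Word (take i l)) * Poly_Mapping.lookup q (Word (drop i l)))"
proof -
  let ?P = "(\<lambda>i. Word (take i l)) ` {..length l}"
  let ?f = "\<lambda>u. Poly_Mapping.lookup p u * (\<Sum>w. Poly_Mapping.lookup q w when Word l = u + w)"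
  have split: "Word l = u + w \<longleftrightarrow> (\<exists>i\<le>length l. u = Word (take i l) \<and> w = Word (drop i l))" for u w
  proof
    assume *: "Word l = u + w"
    have "u = Word (take (length (letters u)) l)" "w = Word (drop (length (letters u)) l)"
      using * by (cases u; cases w; simp add: plus_word_def)+
    moreover have "length (letters u) \<le> length l" using * by (simp add: plus_word_def)
    ultimately show "\<exists>i\<le>length l. u = Word (take i l) \<and> w = Word (drop i l)" by blast
  qed (auto simp: plus_word_def)
  have "{u. ?f u \<noteq> 0} \<subseteq> ?P"
  proof
    fix u assume "u \<in> {u. ?f u \<noteq> 0}"
    hence "?f u \<noteq> 0" by simp
    hence "\<exists>w. Word l = u + w"
      by (intro ccontr[of "\<exists>w. Word l = u + w"]) auto
    thus "u \<in> ?P" using split by auto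
  qed
  hence "Poly_Mapping.lookup (p * q) (Word l) = sum ?f ?P"
    by (simp add: lookup_mult Sum_any.expand_superset)
  also have "\<dots> = (\<Sum>i\<le>length l. ?f (Word (take i l)))"
  proof (subst sum.reindex)
    show "inj_on (\<lambda>i. Word (take i l)) {..length l}"
      by (rule inj_onI) (metis atMost_iff length_take min.absorb2 word.inject)
  qed simp
  also have "\<dots> = (\<Sum>i\<le>length l. Poly_Mapping.lookup p (Word (take i l)) * Poly_Mapping.lookup q (Word (drop i l)))"
  proof (rule sum.cong[OF refl])
    fix i assume "i \<in> {..length l}"
    hence "Word l = Word (take i l) + w \<longleftrightarrow> w = Word (drop i l)" for w
      by (cases w) (auto simp: plus_word_def, metis append_take_drop_id same_append_eq)
    thus "?f (Word (take i l)) = Poly_Mapping.lookup p (Word (take i l)) * Poly_Mapping.lookup q (Word (drop i l))"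
      by simp
  qed
  finally show ?thesis .
qed

lemma ring_tensor_algebra: "ring (tensor_algebra V)"
proof (rule ringI)
  have mult_closed: "set (letters w) \<subseteq> V"
    if pq: "\<forall>w\<in>Poly_Mapping.keys p. set (letters w) \<subseteq> V" "\<forall>w\<in>Poly_Mapping.keys q. set (letters w) \<subseteq> V"
      "w \<in> Poly_Mapping.keys (p * q)" for p q :: "'a word \<Rightarrow>\<^sub>0 complex" and w
  proof -
    obtain a b where "w = a + b" "a \<in> Poly_Mapping.keys p" "b \<in> Poly_Mapping.keys q"
      using pq(3) keys_mult[of p q] by blast
    thus ?thesis using pq(1,2) by (auto simp: plus_word_def)
  qed
  show "abelian_group (tensor_algebra V)"
  proof (rule abelian_groupI)
    fix x assume "x \<in> carrier (tensor_algebra V)"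
    thus "\<exists>y\<in>carrier (tensor_algebra V). y \<oplus>\<^bsub>tensor_algebra V\<^esub> x = \<zero>\<^bsub>tensor_algebra V\<^esub>"
      by (intro bexI[of _ "- x"]) (auto simp: tensor_algebra_def in_keys_iff)
  next
    fix x y assume "x \<in> carrier (tensor_algebra V)" "y \<in> carrier (tensor_algebra V)"
    thus "x \<oplus>\<^bsub>tensor_algebra V\<^esub> y \<in> carrier (tensor_algebra V)"
      using Poly_Mapping.keys_add[of x y] by (fastforce simp: tensor_algebra_def)
  qed (simp_all add: tensor_algebra_def add_ac)
  show "Group.monoid (tensor_algebra V)"
  proof (rule monoidI)
    fix x y assume "x \<in> carrier (tensor_algebra V)" "y \<in> carrier (tensor_algebra V)"
    thus "x \<otimes>\<^bsub>tensor_algebra V\<^esub> y \<in> carrier (tensor_algebra V)"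
      using mult_closed[of x y] unfolding tensor_algebra_def by simp
  qed (simp_all add: tensor_algebra_def mult.assoc zero_word_def)
qed (simp_all add: tensor_algebra_def distrib_left distrib_right)

section \<open>Quotients of graded algebras\<close>

text \<open>The quotient algebras are records with more fields than \<^const>\<open>FactRing\<close>; the ring axioms
  depend only on the ring fields and therefore transfer.\<close>

lemma ring_cong:
  assumes "ring R" "carrier S = carrier R" "mult S = mult R" "one S = one R"
    "zero S = zero R" "add S = add R"
  shows "ring S"
proof -
  interpret R: ring R by fact
  show ?thesis
  proof (rule ringI)
    show "abelian_group S"
      by (rule abelian_groupI) (use assms R.a_assoc R.a_comm R.add.l_inv_ex in auto)
    show "Group.monoid S"
      by (rule monoidI) (use assms R.m_assoc in auto)
  qed (use assms R.l_distr R.r_distr in auto)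
qed

lemma ring_quot_algebra: "ideal I A \<Longrightarrow> ring (quot_algebra A I)"
  by (rule ring_cong[OF ideal.quotient_is_ring]) (simp_all add: quot_algebra_def)


text \<open>Negatives come for free, since \<open>- x = (- 1) x\<close>.\<close>

lemma (in ring) idealI_absorbing:
  assumes "I \<subseteq> carrier R" "\<zero> \<in> I" "\<And>x y. x \<in> I \<Longrightarrow> y \<in> I \<Longrightarrow> x \<oplus> y \<in> I"
    and "\<And>x r. x \<in> I \<Longrightarrow> r \<in> carrier R \<Longrightarrow> r \<otimes> x \<in> I"
    and "\<And>x r. x \<in> I \<Longrightarrow> r \<in> carrier R \<Longrightarrow> x \<otimes> r \<in> I"
  shows "ideal I R"
proof (rule idealI)
  show "subgroup I (add_monoid R)"
  proof (rule add.subgroupI)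
    fix x assume x: "x \<in> I"
    hence "(\<ominus> \<one>) \<otimes> x \<in> I" using assms(4) by simp
    thus "\<ominus> x \<in> I"
      using x assms(1) by (simp add: l_minus subset_iff)
  qed (use assms in auto)
qed (use assms ring_axioms in auto)

text \<open>In the tensor algebra the scalar \<open>c\<close> acts as multiplication by the element \<open>c \<cdot> 1\<close>. This property
  passes to quotients, and it is the reason why ideals are stable under scalars and why the scalar
  multiplication of a quotient, defined as a union over a coset, is single-valued.\<close>

definition scalars_by_mult :: "('a, 'x) graded_algebra_scheme \<Rightarrow> bool" where
  "scalars_by_mult A \<longleftrightarrow>
    (\<forall>c. \<exists>e\<in>carrier A. \<forall>x\<in>carrier A. c \<odot>\<^bsub>A\<^esub> x = e \<otimes>\<^bsub>A\<^esub> x)"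

lemma quot_algebra_carrier: "carrier (quot_algebra A I) = (\<lambda>x. I +>\<^bsub>A\<^esub> x) ` carrier A"
  by (auto simp: quot_algebra_def FactRing_def A_RCOSETS_defs a_r_coset_def r_coset_def)

lemma
  assumes "ideal I A" "x \<in> carrier A" "y \<in> carrier A"
  shows quot_algebra_mult:
      "(I +>\<^bsub>A\<^esub> x) \<otimes>\<^bsub>quot_algebra A I\<^esub> (I +>\<^bsub>A\<^esub> y) = I +>\<^bsub>A\<^esub> (x \<otimes>\<^bsub>A\<^esub> y)"
    and quot_algebra_add:
      "(I +>\<^bsub>A\<^esub> x) \<oplus>\<^bsub>quot_algebra A I\<^esub> (I +>\<^bsub>A\<^esub> y) = I +>\<^bsub>A\<^esub> (x \<oplus>\<^bsub>A\<^esub> y)"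
    and quot_algebra_eq_iff: "I +>\<^bsub>A\<^esub> x = I +>\<^bsub>A\<^esub> y \<longleftrightarrow> x \<ominus>\<^bsub>A\<^esub> y \<in> I"
proof -
  interpret ideal I A by fact
  show "(I +>\<^bsub>A\<^esub> x) \<otimes>\<^bsub>quot_algebra A I\<^esub> (I +>\<^bsub>A\<^esub> y) = I +>\<^bsub>A\<^esub> (x \<otimes>\<^bsub>A\<^esub> y)"
    "(I +>\<^bsub>A\<^esub> x) \<oplus>\<^bsub>quot_algebra A I\<^esub> (I +>\<^bsub>A\<^esub> y) = I +>\<^bsub>A\<^esub> (x \<oplus>\<^bsub>A\<^esub> y)"
    using assms(2,3) by (simp_all add: quot_algebra_def FactRing_def rcoset_mult_add a_rcos_sum)
  show "I +>\<^bsub>A\<^esub> x = I +>\<^bsub>A\<^esub> y \<longleftrightarrow> x \<ominus>\<^bsub>A\<^esub> y \<in> I"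
    using quotient_eq_iff_same_a_r_cos[OF is_ideal assms(2,3)] by simp
qed

lemma quot_algebra_zero: "ideal I A \<Longrightarrow> zero (quot_algebra A I) = I +>\<^bsub>A\<^esub> \<zero>\<^bsub>A\<^esub>"
  using abelian_subgroup.a_rcos_const[OF abelian_subgroupI3, OF ideal.axioms(1) ring.is_abelian_group[OF ideal.axioms(2)]]
    additive_subgroup.zero_closed[OF ideal.axioms(1)]
  by (fastforce simp: quot_algebra_def FactRing_def)

lemma quot_algebra_smult:
  assumes "ideal I A" "scalars_by_mult A" "x \<in> carrier A"
  shows "c \<odot>\<^bsub>quot_algebra A I\<^esub> (I +>\<^bsub>A\<^esub> x) = I +>\<^bsub>A\<^esub> (c \<odot>\<^bsub>A\<^esub> x)"
proof -
  interpret ideal I A by fact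
  obtain e where e: "e \<in> carrier A" "\<And>x. x \<in> carrier A \<Longrightarrow> c \<odot>\<^bsub>A\<^esub> x = e \<otimes>\<^bsub>A\<^esub> x"
    using assms(2) unfolding scalars_by_mult_def by blast
  have "I +>\<^bsub>A\<^esub> (c \<odot>\<^bsub>A\<^esub> y) = I +>\<^bsub>A\<^esub> (c \<odot>\<^bsub>A\<^esub> x)" if "y \<in> I +>\<^bsub>A\<^esub> x" for y
  proof -
    have y: "y \<in> carrier A" using that assms(3) a_r_coset_subset_G a_subset by blast
    have "I +>\<^bsub>A\<^esub> y = I +>\<^bsub>A\<^esub> x" using a_repr_independence[OF that assms(3) a_subgroup] by simp
    thus ?thesis
      using quot_algebra_mult[OF assms(1) e(1) y] quot_algebra_mult[OF assms(1) e(1) assms(3)] e(2) y assms(3)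
      by simp
  qed
  hence "(\<Union>y\<in>I +>\<^bsub>A\<^esub> x. I +>\<^bsub>A\<^esub> (c \<odot>\<^bsub>A\<^esub> y)) = (\<Union>y\<in>I +>\<^bsub>A\<^esub> x. I +>\<^bsub>A\<^esub> (c \<odot>\<^bsub>A\<^esub> x))"
    by (rule SUP_cong[OF refl])
  moreover have "I +>\<^bsub>A\<^esub> x \<noteq> {}" using a_rcos_self assms(3) by blast
  ultimately show ?thesis by (simp add: quot_algebra_def)
qed

lemma scalars_by_mult_quot_algebra:
  assumes "ideal I A" "scalars_by_mult A"
  shows "scalars_by_mult (quot_algebra A I)"
  unfolding scalars_by_mult_def
proof
  fix c
  obtain e where e: "e \<in> carrier A" "\<And>x. x \<in> carrier A \<Longrightarrow> c \<odot>\<^bsub>A\<^esub> x = e \<otimes>\<^bsub>A\<^esub> x"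
    using assms(2) unfolding scalars_by_mult_def by blast
  show "\<exists>e\<in>carrier (quot_algebra A I). \<forall>x\<in>carrier (quot_algebra A I).
      c \<odot>\<^bsub>quot_algebra A I\<^esub> x = e \<otimes>\<^bsub>quot_algebra A I\<^esub> x"
    using e quot_algebra_mult[OF assms(1) e(1)] quot_algebra_smult[OF assms]
    by (intro bexI[of _ "I +>\<^bsub>A\<^esub> e"]) (auto simp: quot_algebra_carrier)
qed

section \<open>The cohomology algebra through representatives in the tensor algebra\<close>

abbreviation word_coeff :: "('v word \<Rightarrow>\<^sub>0 complex) \<Rightarrow> 'v list \<Rightarrow> complex" where
  "word_coeff p l \<equiv> Poly_Mapping.lookup p (Word l)"

abbreviation word_polys :: "'v set \<Rightarrow> ('v word \<Rightarrow>\<^sub>0 complex) set" where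
  "word_polys V \<equiv> carrier (tensor_algebra V)"

abbreviation letter :: "'v \<Rightarrow> ('v word \<Rightarrow>\<^sub>0 complex)" where
  "letter v \<equiv> Poly_Mapping.single (Word [v]) 1"

lemma tensor_algebra_simps [simp]:
  "mult (tensor_algebra V) = (*)" "one (tensor_algebra V) = 1" "zero (tensor_algebra V) = 0"
  "add (tensor_algebra V) = (+)" "smult (tensor_algebra V) = (\<lambda>c p. Poly_Mapping.single 0 c * p)"
  by (simp_all add: tensor_algebra_def)

lemma word_polys_iff: "p \<in> word_polys V \<longleftrightarrow> (\<forall>w\<in>Poly_Mapping.keys p. set (letters w) \<subseteq> V)"
  by (simp add: tensor_algebra_def)

lemma deg_word_polys: "p \<in> deg (tensor_algebra V) i \<Longrightarrow> p \<in> word_polys V"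
  by (simp add: tensor_algebra_def)

lemma word_polys_closed:
  "p \<in> word_polys V \<Longrightarrow> q \<in> word_polys V \<Longrightarrow> p + q \<in> word_polys V"
  "p \<in> word_polys V \<Longrightarrow> q \<in> word_polys V \<Longrightarrow> p * q \<in> word_polys V"
  "0 \<in> word_polys V" "1 \<in> word_polys V" "v \<in> V \<Longrightarrow> letter v \<in> word_polys V"
  "Poly_Mapping.single 0 c \<in> word_polys V"
proof -
  interpret ring "tensor_algebra V" by (rule ring_tensor_algebra)
  show "p \<in> word_polys V \<Longrightarrow> q \<in> word_polys V \<Longrightarrow> p + q \<in> word_polys V"
    "p \<in> word_polys V \<Longrightarrow> q \<in> word_polys V \<Longrightarrow> p * q \<in> word_polys V"
    "0 \<in> word_polys V" "1 \<in> word_polys V"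
    using a_closed[of p q] m_closed[of p q] zero_closed one_closed by simp_all
qed (simp_all add: word_polys_iff zero_word_def)

lemma tensor_algebra_a_inv: "p \<in> word_polys V \<Longrightarrow> \<ominus>\<^bsub>tensor_algebra V\<^esub> p = - p"
  by (rule abelian_group.minus_equality[OF ring.is_abelian_group[OF ring_tensor_algebra]])
     (auto simp: word_polys_iff in_keys_iff)

lemma tensor_algebra_a_minus:
  "p \<in> word_polys V \<Longrightarrow> q \<in> word_polys V \<Longrightarrow> p \<ominus>\<^bsub>tensor_algebra V\<^esub> q = p - q"
  by (simp add: a_minus_def tensor_algebra_a_inv)

lemma word_coeff_mult:
  fixes p q :: "'v word \<Rightarrow>\<^sub>0 complex"
  shows "word_coeff (p * q) [] = word_coeff p [] * word_coeff q []"
  and "word_coeff (p * q) [a] = word_coeff p [] * word_coeff q [a] + word_coeff p [a] * word_coeff q []"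
  and "word_coeff (p * q) [a, b] = word_coeff p [] * word_coeff q [a, b]
     + word_coeff p [a] * word_coeff q [b] + word_coeff p [a, b] * word_coeff q []"
  by (simp_all add: lookup_mult_word)

lemma ideal_exterior_ideal: "ideal (exterior_ideal V) (tensor_algebra V)"
  unfolding exterior_ideal_def
  by (rule ring.genideal_ideal[OF ring_tensor_algebra])
     (auto intro!: word_polys_closed(2) dest: deg_word_polys)

lemma scalars_by_mult_tensor_algebra: "scalars_by_mult (tensor_algebra V)"
  using word_polys_closed(6) by (auto simp: scalars_by_mult_def)

lemma ring_exterior_algebra: "ring (exterior_algebra V)"
  unfolding exterior_algebra_def by (rule ring_quot_algebra[OF ideal_exterior_ideal])

lemma ideal_raag_ideal: "ideal (raag_ideal V E) (exterior_algebra V)"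
  unfolding raag_ideal_def
proof (rule ring.genideal_ideal[OF ring_exterior_algebra], safe)
  fix v w assume "v \<in> V" "w \<in> V"
  thus "exterior_gen V v \<otimes>\<^bsub>exterior_algebra V\<^esub> exterior_gen V w \<in> carrier (exterior_algebra V)"
    by (intro ring.ring_simprules(5)[OF ring_exterior_algebra])
       (auto simp: exterior_gen_def exterior_algebra_def quot_algebra_carrier word_polys_closed)
qed

text \<open>The composite of the two quotient maps. Through it, all computations in the cohomology algebra are
  done with representatives in the tensor algebra.\<close>

definition raag_class :: "'v set \<Rightarrow> 'v set set \<Rightarrow> ('v word \<Rightarrow>\<^sub>0 complex) \<Rightarrow> 'v raag_elem" where
  "raag_class V E p =
    raag_ideal V E +>\<^bsub>exterior_algebra V\<^esub> (exterior_ideal V +>\<^bsub>tensor_algebra V\<^esub> p)"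

lemma raag_gen_class: "raag_gen V E v = raag_class V E (letter v)"
  by (simp add: raag_gen_def raag_class_def exterior_gen_def)

lemma raag_algebra_fields:
  "carrier (raag_algebra V E) = carrier (quot_algebra (exterior_algebra V) (raag_ideal V E))"
  "mult (raag_algebra V E) = mult (quot_algebra (exterior_algebra V) (raag_ideal V E))"
  "add (raag_algebra V E) = add (quot_algebra (exterior_algebra V) (raag_ideal V E))"
  "zero (raag_algebra V E) = zero (quot_algebra (exterior_algebra V) (raag_ideal V E))"
  "smult (raag_algebra V E) = smult (quot_algebra (exterior_algebra V) (raag_ideal V E))"
  "deg (raag_algebra V E) = deg (quot_algebra (exterior_algebra V) (raag_ideal V E))"
  "diff (raag_algebra V E) = (\<lambda>_. zero (quot_algebra (exterior_algebra V) (raag_ideal V E)))"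
  by (simp_all add: raag_algebra_def graded_algebra.defs cdga.defs)

lemma exterior_class_carrier:
  "p \<in> word_polys V \<Longrightarrow> exterior_ideal V +>\<^bsub>tensor_algebra V\<^esub> p \<in> carrier (exterior_algebra V)"
  by (simp add: exterior_algebra_def quot_algebra_carrier)

lemma raag_carrier: "carrier (raag_algebra V E) = raag_class V E ` word_polys V"
  by (simp add: raag_algebra_fields quot_algebra_carrier raag_class_def image_image exterior_algebra_def)

lemma raag_deg: "deg (raag_algebra V E) i = raag_class V E ` deg (tensor_algebra V) i"
  by (simp add: raag_algebra_fields quot_algebra_def raag_class_def image_image exterior_algebra_def)

lemma raag_zero: "zero (raag_algebra V E) = raag_class V E 0"
  using quot_algebra_zero[OF ideal_raag_ideal[of V E]] quot_algebra_zero[OF ideal_exterior_ideal[of V]]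
  by (simp add: raag_algebra_fields raag_class_def exterior_algebra_def)

lemma raag_diff: "diff (raag_algebra V E) a = raag_class V E 0"
  using raag_zero[of V E] by (simp add: raag_algebra_fields)

lemma
  assumes "p \<in> word_polys V" "q \<in> word_polys V"
  shows raag_mult: "raag_class V E p \<otimes>\<^bsub>raag_algebra V E\<^esub> raag_class V E q = raag_class V E (p * q)"
    and raag_add: "raag_class V E p \<oplus>\<^bsub>raag_algebra V E\<^esub> raag_class V E q = raag_class V E (p + q)"
  using quot_algebra_mult[OF ideal_raag_ideal exterior_class_carrier exterior_class_carrier, OF assms, of E]
    quot_algebra_mult[OF ideal_exterior_ideal assms]
    quot_algebra_add[OF ideal_raag_ideal exterior_class_carrier exterior_class_carrier, OF assms, of E]
    quot_algebra_add[OF ideal_exterior_ideal assms]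
  by (simp_all add: raag_algebra_fields raag_class_def flip: exterior_algebra_def)

lemma raag_smult:
  assumes "p \<in> word_polys V"
  shows "c \<odot>\<^bsub>raag_algebra V E\<^esub> raag_class V E p = raag_class V E (Poly_Mapping.single 0 c * p)"
  using quot_algebra_smult[OF ideal_raag_ideal _ exterior_class_carrier, OF _ assms, of E c]
    quot_algebra_smult[OF ideal_exterior_ideal scalars_by_mult_tensor_algebra assms, of c]
    scalars_by_mult_quot_algebra[OF ideal_exterior_ideal scalars_by_mult_tensor_algebra, of V]
  by (simp add: raag_algebra_fields raag_class_def flip: exterior_algebra_def)

lemma raag_class_square:
  assumes "p \<in> deg (tensor_algebra V) 1"
  shows "raag_class V E (p * p) = raag_class V E 0"
proof -
  have p: "p \<in> word_polys V" using assms by (rule deg_word_polys)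
  have "p * p \<in> exterior_ideal V" unfolding exterior_ideal_def
    by (rule subsetD[OF ring.genideal_self[OF ring_tensor_algebra]])
       (use assms word_polys_closed(2) in \<open>auto dest: deg_word_polys\<close>)
  hence "exterior_ideal V +>\<^bsub>tensor_algebra V\<^esub> (p * p) = exterior_ideal V +>\<^bsub>tensor_algebra V\<^esub> 0"
    using p by (subst quot_algebra_eq_iff[OF ideal_exterior_ideal])
      (simp_all add: word_polys_closed tensor_algebra_a_minus)
  thus ?thesis by (simp add: raag_class_def)
qed

lemma raag_class_nonadjacent:
  assumes "v \<in> V" "w \<in> V" "{v, w} \<notin> E"
  shows "raag_class V E (letter v * letter w) = raag_class V E 0"
proof -
  let ?x = "exterior_gen V v \<otimes>\<^bsub>exterior_algebra V\<^esub> exterior_gen V w"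
  have gen: "exterior_gen V a \<in> carrier (exterior_algebra V)" if "a \<in> V" for a
    using that exterior_class_carrier[OF word_polys_closed(5)] by (simp add: exterior_gen_def)
  have "?x \<in> raag_ideal V E" unfolding raag_ideal_def
    by (rule subsetD[OF ring.genideal_self[OF ring_exterior_algebra]])
       (use assms gen in \<open>auto intro!: ring.ring_simprules(5)[OF ring_exterior_algebra]\<close>)
  hence "raag_ideal V E +>\<^bsub>exterior_algebra V\<^esub> ?x = zero (raag_algebra V E)"
    using abelian_subgroup.a_rcos_const[OF abelian_subgroupI3, OF ideal.axioms(1) ring.is_abelian_group[OF ideal.axioms(2)], OF ideal_raag_ideal ideal_raag_ideal]
    by (simp add: raag_algebra_fields quot_algebra_def FactRing_def)
  thus ?thesis
    using assms quot_algebra_mult[OF ideal_exterior_ideal word_polys_closed(5) word_polys_closed(5), of v V w]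
    by (simp add: raag_zero raag_class_def exterior_gen_def flip: exterior_algebra_def)
qed

text \<open>The coefficient of \<open>v\<^sup>* w\<^sup>*\<close> in the exterior square: the part of the coefficient at the word
  \<open>v w\<close> that survives \<open>x x = 0\<close>.\<close>

definition antisym_coeff :: "('v word \<Rightarrow>\<^sub>0 complex) \<Rightarrow> 'v \<Rightarrow> 'v \<Rightarrow> complex" where
  "antisym_coeff p v w = word_coeff p [v, w] - word_coeff p [w, v]"

text \<open>An ideal large enough to contain all relations and small enough to detect the basis of the quotient
  in degrees 1 and 2: killing degrees 0 and 1 makes the conditions in degree 2 stable under
  multiplication.\<close>

definition edge_symmetric :: "'v set \<Rightarrow> 'v set set \<Rightarrow> ('v word \<Rightarrow>\<^sub>0 complex) set" where
  "edge_symmetric V E = {p \<in> word_polys V. word_coeff p [] = 0 \<and> (\<forall>v. word_coeff p [v] = 0) \<and>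
    (\<forall>v w. {v, w} \<in> E \<longrightarrow> antisym_coeff p v w = 0)}"

lemma edge_symmetricD:
  assumes "p \<in> edge_symmetric V E"
  shows "p \<in> word_polys V" "word_coeff p [] = 0" "word_coeff p [v] = 0"
    "{v, w} \<in> E \<Longrightarrow> antisym_coeff p v w = 0"
  using assms unfolding edge_symmetric_def by blast+

lemma ideal_edge_symmetric: "ideal (edge_symmetric V E) (tensor_algebra V)"
proof -
  have add: "antisym_coeff (p + q) v w = antisym_coeff p v w + antisym_coeff q v w"
    for p q :: "'a word \<Rightarrow>\<^sub>0 complex" and v w
    by (simp add: antisym_coeff_def lookup_add)
  have mult: "antisym_coeff (r * p) v w = word_coeff r [] * antisym_coeff p v w"
    "antisym_coeff (p * r) v w = antisym_coeff p v w * word_coeff r []"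
    if "word_coeff p [] = 0" "\<forall>a. word_coeff p [a] = 0"
    for p r :: "'a word \<Rightarrow>\<^sub>0 complex" and v w
    using that by (simp_all add: antisym_coeff_def word_coeff_mult algebra_simps)
  show ?thesis
    by (rule ring.idealI_absorbing[OF ring_tensor_algebra])
       (auto simp: edge_symmetric_def word_polys_closed lookup_add word_coeff_mult add mult,
         simp_all add: antisym_coeff_def)
qed

text \<open>The square of \<open>\<Sum> x\<^sub>v v\<close> has the symmetric coefficients \<open>x\<^sub>v x\<^sub>w\<close>.\<close>

lemma exterior_ideal_subset: "exterior_ideal V \<subseteq> edge_symmetric V E"
  unfolding exterior_ideal_def
proof (rule ring.genideal_minimal[OF ring_tensor_algebra ideal_edge_symmetric], safe)
  fix x assume x: "x \<in> deg (tensor_algebra V) 1"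
  hence "x \<in> word_polys V" "word_coeff x [] = 0"
    by (auto simp: tensor_algebra_def simp flip: not_in_keys_iff_lookup_eq_zero)
  thus "x \<otimes>\<^bsub>tensor_algebra V\<^esub> x \<in> edge_symmetric V E"
    by (simp add: edge_symmetric_def word_polys_closed word_coeff_mult antisym_coeff_def)
qed

text \<open>The remaining relations \<open>v\<^sup>* w\<^sup>*\<close> concern non-edges, and \<^const>\<open>edge_symmetric\<close> only constrains
  edges; so its image in the exterior algebra is an ideal containing them.\<close>

lemma raag_ideal_subset:
  "raag_ideal V E \<subseteq> (\<lambda>p. exterior_ideal V +>\<^bsub>tensor_algebra V\<^esub> p) ` edge_symmetric V E"
  unfolding raag_ideal_def
proof (rule ring.genideal_minimal[OF ring_exterior_algebra], goal_cases)
  case 1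
  interpret K: ideal "edge_symmetric V E" "tensor_algebra V" by (rule ideal_edge_symmetric)
  have sub: "edge_symmetric V E \<subseteq> word_polys V" unfolding edge_symmetric_def by blast
  let ?c = "\<lambda>p. exterior_ideal V +>\<^bsub>tensor_algebra V\<^esub> p"
  have add: "?c p \<oplus>\<^bsub>exterior_algebra V\<^esub> ?c q = ?c (p + q)"
    and mult: "?c p \<otimes>\<^bsub>exterior_algebra V\<^esub> ?c q = ?c (p * q)"
    if "p \<in> word_polys V" "q \<in> word_polys V" for p q
    using quot_algebra_add[OF ideal_exterior_ideal that] quot_algebra_mult[OF ideal_exterior_ideal that]
    by (simp_all add: exterior_algebra_def)
  have cl: "p + q \<in> edge_symmetric V E" if "p \<in> edge_symmetric V E" "q \<in> edge_symmetric V E" for p q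
    using additive_subgroup.a_closed[OF K.is_additive_subgroup that] by simp
  have absorb: "r * p \<in> edge_symmetric V E" "p * r \<in> edge_symmetric V E"
    if "p \<in> edge_symmetric V E" "r \<in> word_polys V" for p r
    using K.I_l_closed[OF that] K.I_r_closed[OF that] by simp_all
  have carr: "carrier (exterior_algebra V) = ?c ` word_polys V"
    by (simp add: exterior_algebra_def quot_algebra_carrier)
  show ?case
  proof (rule ring.idealI_absorbing[OF ring_exterior_algebra])
    show "?c ` edge_symmetric V E \<subseteq> carrier (exterior_algebra V)"
      unfolding carr using sub by (rule image_mono)
    show "\<zero>\<^bsub>exterior_algebra V\<^esub> \<in> ?c ` edge_symmetric V E"
      using quot_algebra_zero[OF ideal_exterior_ideal[of V]]
        additive_subgroup.zero_closed[OF K.is_additive_subgroup]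
      by (simp add: exterior_algebra_def)
  next
    fix x y assume "x \<in> ?c ` edge_symmetric V E" "y \<in> ?c ` edge_symmetric V E"
    then obtain p q where pq: "x = ?c p" "p \<in> edge_symmetric V E" "y = ?c q" "q \<in> edge_symmetric V E"
      by blast
    hence "x \<oplus>\<^bsub>exterior_algebra V\<^esub> y = ?c (p + q)" using add sub by blast
    thus "x \<oplus>\<^bsub>exterior_algebra V\<^esub> y \<in> ?c ` edge_symmetric V E" using cl pq by blast
  next
    fix x y assume "x \<in> ?c ` edge_symmetric V E" "y \<in> carrier (exterior_algebra V)"
    then obtain p r where pr: "x = ?c p" "p \<in> edge_symmetric V E" "y = ?c r" "r \<in> word_polys V"
      unfolding carr by blast
    hence "y \<otimes>\<^bsub>exterior_algebra V\<^esub> x = ?c (r * p)" "x \<otimes>\<^bsub>exterior_algebra V\<^esub> y = ?c (p * r)"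
      using mult sub by blast+
    thus "y \<otimes>\<^bsub>exterior_algebra V\<^esub> x \<in> ?c ` edge_symmetric V E"
      "x \<otimes>\<^bsub>exterior_algebra V\<^esub> y \<in> ?c ` edge_symmetric V E"
      using absorb pr by blast+
  qed
next
  case 2
  have "letter v * letter w \<in> edge_symmetric V E" if "v \<in> V" "w \<in> V" "{v, w} \<notin> E" for v w
    using that
    by (auto simp: edge_symmetric_def antisym_coeff_def word_polys_closed word_coeff_mult lookup_single when_def insert_commute)
  thus ?case
    by (auto simp: exterior_gen_def exterior_algebra_def quot_algebra_mult[OF ideal_exterior_ideal] word_polys_closed)
qed

text \<open>Linear independence in the cohomology algebra: the generators, and the products of adjacent
  generators up to sign, have well-defined coefficients.\<close>

lemma raag_class_eqD:
  assumes "p \<in> word_polys V" "q \<in> word_polys V" "raag_class V E p = raag_class V E q"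
  shows "word_coeff p [v] = word_coeff q [v]"
    "{v, w} \<in> E \<Longrightarrow> antisym_coeff p v w = antisym_coeff q v w"
proof -
  let ?x = "\<lambda>p. exterior_ideal V +>\<^bsub>tensor_algebra V\<^esub> p"
  have d: "p - q \<in> word_polys V"
    using assms(1,2) ring.ring_simprules(4)[OF ring_tensor_algebra, of p V q] by (simp add: tensor_algebra_a_minus)
  interpret R: ring "exterior_algebra V" by (rule ring_exterior_algebra)
  have "?x p \<ominus>\<^bsub>exterior_algebra V\<^esub> ?x q \<in> raag_ideal V E"
    using assms quot_algebra_eq_iff[OF ideal_raag_ideal exterior_class_carrier exterior_class_carrier, of p V q E]
    by (simp add: raag_class_def)
  moreover have "?x (p - q) \<oplus>\<^bsub>exterior_algebra V\<^esub> ?x q = ?x p"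
    using quot_algebra_add[OF ideal_exterior_ideal d assms(2)] by (simp add: exterior_algebra_def)
  hence "?x p \<ominus>\<^bsub>exterior_algebra V\<^esub> ?x q = ?x (p - q)"
    using exterior_class_carrier[OF d] exterior_class_carrier[OF assms(2)]
    by (metis R.add.inv_solve_right' a_minus_def R.add.m_closed)
  ultimately obtain r where r: "r \<in> edge_symmetric V E" "?x (p - q) = ?x r"
    using raag_ideal_subset[of V E] by auto
  hence "p - q - r \<in> edge_symmetric V E"
    using quot_algebra_eq_iff[OF ideal_exterior_ideal d, of r] exterior_ideal_subset[of V E] d
    by (auto simp: tensor_algebra_a_minus edge_symmetricD(1))
  note * = edge_symmetricD(3)[OF this, of v] edge_symmetricD(4)[OF this, of v w]
    edge_symmetricD(3)[OF r(1), of v] edge_symmetricD(4)[OF r(1), of v w]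
  show "word_coeff p [v] = word_coeff q [v]"
    using *(1,3) by (simp add: lookup_minus)
  show "antisym_coeff p v w = antisym_coeff q v w"
    if "{v, w} \<in> E"
    using *(2,4)[OF that] by (simp add: antisym_coeff_def lookup_minus lookup_add algebra_simps)
qed

section \<open>Tensors with coefficients in a vector space\<close>

definition linear_forms :: "('b::ab_group_add, 'y) cspace_scheme \<Rightarrow> ('b \<Rightarrow> complex) set" where
  "linear_forms M = {f. (\<forall>x\<in>vectors M. \<forall>y\<in>vectors M. f (x + y) = f x + f y) \<and>
    (\<forall>c. \<forall>x\<in>vectors M. f (scale M c x) = c * f x)}"

locale complex_subspace =
  fixes M :: "('b::ab_group_add, 'y) cspace_scheme"
  assumes ambient: "vector_space (scale M)"
    and subspace: "Modules.module.subspace (scale M) (vectors M)"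
begin

interpretation vector_space "scale M" by (rule ambient)

lemma closed:
  "0 \<in> vectors M" "x \<in> vectors M \<Longrightarrow> y \<in> vectors M \<Longrightarrow> x + y \<in> vectors M"
  "x \<in> vectors M \<Longrightarrow> y \<in> vectors M \<Longrightarrow> x - y \<in> vectors M"
  "x \<in> vectors M \<Longrightarrow> scale M c x \<in> vectors M"
  using subspace by (simp_all add: subspace_0 subspace_add subspace_diff subspace_scale)

lemma sum_closed: "(\<And>i. i \<in> I \<Longrightarrow> x i \<in> vectors M) \<Longrightarrow> (\<Sum>i\<in>I. x i) \<in> vectors M"
  by (rule subspace_sum[OF subspace])

text \<open>Extend \<open>x - y\<close> to a basis of the ambient space and take the corresponding coordinate.\<close>

lemma eqI_linear_forms:
  assumes "x \<in> vectors M" "y \<in> vectors M" "\<And>f. f \<in> linear_forms M \<Longrightarrow> f x = f y"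
  shows "x = y"
proof (rule ccontr)
  assume "x \<noteq> y"
  hence "independent {x - y}" by (simp add: independent_insert)
  then obtain B where B: "{x - y} \<subseteq> B" "independent B" "span B = UNIV"
    using extend_basis_superset independent_extend_basis span_extend_basis by metis
  let ?f = "\<lambda>z. representation B z (x - y)"
  have "?f \<in> linear_forms M"
    using B by (auto simp: linear_forms_def representation_add representation_scale)
  hence "?f x - ?f y = 0" using assms(3) by simp
  moreover have "?f x - ?f y = ?f (x - y)" using B representation_diff[of B y x] by (auto simp: subset_iff)
  moreover have "?f (x - y) = 1" using B representation_basis[of B "x - y"] by simp
  ultimately show False by simp
qed

end

lemma bilinear_formsD:
  assumes "\<beta> \<in> bilinear_forms A M"
  shows "a \<in> carrier A \<Longrightarrow> b \<in> carrier A \<Longrightarrow> x \<in> vectors M \<Longrightarrow> \<beta> (a \<oplus>\<^bsub>A\<^esub> b) x = \<beta> a x + \<beta> b x"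
    and "a \<in> carrier A \<Longrightarrow> x \<in> vectors M \<Longrightarrow> y \<in> vectors M \<Longrightarrow> \<beta> a (x + y) = \<beta> a x + \<beta> a y"
    and "a \<in> carrier A \<Longrightarrow> x \<in> vectors M \<Longrightarrow> \<beta> (c \<odot>\<^bsub>A\<^esub> a) x = c * \<beta> a x"
    and "a \<in> carrier A \<Longrightarrow> x \<in> vectors M \<Longrightarrow> \<beta> a (scale M c x) = c * \<beta> a x"
  using assms unfolding bilinear_forms_def by blast+

lemma (in complex_subspace) bilinear_form_sum:
  assumes "\<beta> \<in> bilinear_forms A M" "a \<in> carrier A" "\<And>i. i \<in> I \<Longrightarrow> x i \<in> vectors M"
  shows "\<beta> a (\<Sum>i\<in>I. scale M (c i) (x i)) = (\<Sum>i\<in>I. c i * \<beta> a (x i))"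
proof -
  interpret vector_space "scale M" by (rule ambient)
  have zero: "\<beta> a 0 = 0" using bilinear_formsD(2)[OF assms(1,2) closed(1) closed(1)] by simp
  show ?thesis
    using assms(3)
  proof (induction I rule: infinite_finite_induct)
    case (insert i I)
    have "(\<Sum>i\<in>I. scale M (c i) (x i)) \<in> vectors M"
      using insert.prems closed by (intro sum_closed) auto
    with insert show ?case
      by (simp add: bilinear_formsD[OF assms(1)] assms(2) closed)
  qed (simp_all add: zero)
qed

locale raag_graph =
  fixes V :: "'v set" and E :: "'v set set"
  assumes finite_V: "finite V" and simplicial: "simplicial_graph V E"
begin

abbreviation A :: "'v raag_elem cdga" where "A \<equiv> raag_algebra V E"
abbreviation cls :: "('v word \<Rightarrow>\<^sub>0 complex) \<Rightarrow> 'v raag_elem" where "cls \<equiv> raag_class V E"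
abbreviation gen :: "'v \<Rightarrow> 'v raag_elem" where "gen \<equiv> raag_gen V E"

lemma edgeD: "{v, w} \<in> E \<Longrightarrow> v \<in> V \<and> w \<in> V \<and> v \<noteq> w"
  using simplicial unfolding simplicial_graph_def by (fastforce simp: doubleton_eq_iff)

lemma cls_carrier: "p \<in> word_polys V \<Longrightarrow> cls p \<in> carrier A"
  by (simp add: raag_carrier)

lemma gen_carrier: "v \<in> V \<Longrightarrow> gen v \<in> carrier A"
  by (simp add: raag_gen_class cls_carrier word_polys_closed)

lemma gen_mult: "v \<in> V \<Longrightarrow> w \<in> V \<Longrightarrow> gen v \<otimes>\<^bsub>A\<^esub> gen w = cls (letter v * letter w)"
  by (simp add: raag_gen_class raag_mult word_polys_closed)

lemma
  assumes "\<beta> \<in> bilinear_forms A M" "p \<in> word_polys V" "x \<in> vectors M"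
  shows bilinear_cls_add: "q \<in> word_polys V \<Longrightarrow> \<beta> (cls (p + q)) x = \<beta> (cls p) x + \<beta> (cls q) x"
    and bilinear_cls_scale: "\<beta> (cls (Poly_Mapping.single 0 c * p)) x = c * \<beta> (cls p) x"
    and bilinear_cls_zero: "\<beta> (cls 0) x = 0"
proof -
  show "\<beta> (cls (p + q)) x = \<beta> (cls p) x + \<beta> (cls q) x" if "q \<in> word_polys V"
    using bilinear_formsD(1)[OF assms(1) cls_carrier cls_carrier assms(3), OF assms(2) that] assms(2) that
    by (simp add: raag_add)
  show *: "\<beta> (cls (Poly_Mapping.single 0 c * p)) x = c * \<beta> (cls p) x" for c
    using bilinear_formsD(3)[OF assms(1) cls_carrier assms(3), OF assms(2), of c] assms(2)
    by (simp add: raag_smult)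
  show "\<beta> (cls 0) x = 0" using *[of 0] by simp
qed

text \<open>Any linear functional \<open>\<phi>\<close> of representatives that respects the relations, together with a linear form
  \<open>f\<close> on the coefficients, gives the bilinear form \<open>\<phi> \<otimes> f\<close>. These forms separate tensors.\<close>

lemma bilinear_form_of_coeff:
  assumes "\<And>p q. p \<in> word_polys V \<Longrightarrow> q \<in> word_polys V \<Longrightarrow> cls p = cls q \<Longrightarrow> \<phi> p = \<phi> q"
    and "\<And>p q. \<phi> (p + q) = \<phi> p + \<phi> q"
    and "\<And>c p. \<phi> (Poly_Mapping.single 0 c * p) = c * \<phi> p"
    and "f \<in> linear_forms M"
  obtains \<beta> where "\<beta> \<in> bilinear_forms A M"
    and "\<And>p x. p \<in> word_polys V \<Longrightarrow> \<beta> (cls p) x = \<phi> p * f x"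
proof
  let ?\<beta> = "\<lambda>a x. \<phi> (SOME p. p \<in> word_polys V \<and> cls p = a) * f x"
  show cls: "?\<beta> (cls p) x = \<phi> p * f x" if "p \<in> word_polys V" for p x
  proof -
    have "(SOME q. q \<in> word_polys V \<and> cls q = cls p) \<in> word_polys V \<and>
        cls (SOME q. q \<in> word_polys V \<and> cls q = cls p) = cls p"
      by (rule someI[of "\<lambda>q. q \<in> word_polys V \<and> cls q = cls p" p]) (use that in simp)
    thus ?thesis
      using assms(1)[of "SOME q. q \<in> word_polys V \<and> cls q = cls p" p] that by simp
  qed
  have f: "f (x + y) = f x + f y" "f (scale M c x) = c * f x" if "x \<in> vectors M" "y \<in> vectors M" for x y c
    using assms(4) that by (auto simp: linear_forms_def)
  have "?\<beta> (a \<oplus>\<^bsub>A\<^esub> b) x = ?\<beta> a x + ?\<beta> b x" "?\<beta> (c \<odot>\<^bsub>A\<^esub> a) x = c * ?\<beta> a x"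
    if ab: "a \<in> carrier A" "b \<in> carrier A" for a b c x
  proof -
    obtain p q where pq: "a = cls p" "b = cls q" "p \<in> word_polys V" "q \<in> word_polys V"
      using ab unfolding raag_carrier by blast
    have eq: "a \<oplus>\<^bsub>A\<^esub> b = cls (p + q)" "c \<odot>\<^bsub>A\<^esub> a = cls (Poly_Mapping.single 0 c * p)"
      and mem: "p + q \<in> word_polys V" "Poly_Mapping.single 0 c * p \<in> word_polys V"
      using pq by (simp_all add: raag_add raag_smult word_polys_closed)
    show "?\<beta> (a \<oplus>\<^bsub>A\<^esub> b) x = ?\<beta> a x + ?\<beta> b x" "?\<beta> (c \<odot>\<^bsub>A\<^esub> a) x = c * ?\<beta> a x"
      unfolding eq cls[OF mem(1)] cls[OF mem(2)] unfolding pq(1,2) cls[OF pq(3)] cls[OF pq(4)]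
      by (simp_all add: assms(2,3) algebra_simps)
  qed
  thus "?\<beta> \<in> bilinear_forms A M"
    unfolding bilinear_forms_def by (simp add: f algebra_simps)
qed

lemma tensor_sum_cong:
  assumes "\<And>\<beta>. \<beta> \<in> bilinear_forms B M \<Longrightarrow> (\<Sum>i\<in>I. \<beta> (a i) (x i)) = (\<Sum>j\<in>J. \<beta> (b j) (y j))"
  shows "tensor_sum B M I a x = tensor_sum B M J b y"
  using assms by (auto simp: tensor_sum_def)

lemma deg0_expand:
  "p \<in> deg (tensor_algebra V) 0 \<Longrightarrow> p = Poly_Mapping.single 0 (word_coeff p []) * 1"
proof (rule poly_mapping_eqI)
  fix w assume p: "p \<in> deg (tensor_algebra V) 0"
  show "Poly_Mapping.lookup p w = Poly_Mapping.lookup (Poly_Mapping.single 0 (word_coeff p []) * 1) w"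
  proof (cases "w = Word []")
    case False
    hence "length (letters w) \<noteq> 0" by (cases w) simp
    hence "Poly_Mapping.lookup p w = 0" using p by (auto simp: tensor_algebra_def in_keys_iff)
    thus ?thesis using False by (simp add: lookup_single zero_word_def when_def)
  qed (simp add: lookup_single zero_word_def)
qed

lemma deg1_expand:
  assumes "p \<in> deg (tensor_algebra V) 1"
  shows "p = (\<Sum>v\<in>V. Poly_Mapping.single 0 (word_coeff p [v]) * letter v)"
proof (rule poly_mapping_eqI)
  fix w
  have "Poly_Mapping.lookup (\<Sum>v\<in>V. Poly_Mapping.single 0 (word_coeff p [v]) * letter v) w
      = (\<Sum>v\<in>V. word_coeff p [v] when Word [v] = w)"
    by (simp add: lookup_sum mult_single lookup_single)
  also have "\<dots> = Poly_Mapping.lookup p w"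
  proof (cases "\<exists>a\<in>V. w = Word [a]")
    case True
    then obtain a where a: "a \<in> V" "w = Word [a]" by blast
    have "(\<Sum>v\<in>V. word_coeff p [v] when Word [v] = w) = (\<Sum>v\<in>V. if v = a then word_coeff p [v] else 0)"
      by (rule sum.cong) (auto simp: a when_def)
    thus ?thesis using a finite_V by simp
  next
    case False
    hence "w \<notin> Poly_Mapping.keys p"
      using assms by (cases w) (fastforce simp: tensor_algebra_def length_Suc_conv)
    hence "Poly_Mapping.lookup p w = 0" by (simp add: in_keys_iff)
    moreover have "(\<Sum>v\<in>V. word_coeff p [v] when Word [v] = w) = 0"
      using False by (intro sum.neutral) (auto simp: when_def)
    ultimately show ?thesis by simp
  qed
  finally show "Poly_Mapping.lookup p w =
    Poly_Mapping.lookup (\<Sum>v\<in>V. Poly_Mapping.single 0 (word_coeff p [v]) * letter v) w" ..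
qed

lemma bilinear_deg1:
  assumes "\<beta> \<in> bilinear_forms A M" "p \<in> deg (tensor_algebra V) 1" "x \<in> vectors M"
  shows "\<beta> (cls p) x = (\<Sum>v\<in>V. word_coeff p [v] * \<beta> (gen v) x)"
proof -
  have "(\<Sum>v\<in>S. Poly_Mapping.single 0 (c v) * letter v) \<in> word_polys V \<and>
      \<beta> (cls (\<Sum>v\<in>S. Poly_Mapping.single 0 (c v) * letter v)) x = (\<Sum>v\<in>S. c v * \<beta> (gen v) x)"
    if "finite S" "S \<subseteq> V" for S c
    using that
  proof (induction S rule: finite_induct)
    case empty
    show ?case by (simp add: bilinear_cls_zero[OF assms(1) word_polys_closed(3) assms(3)] word_polys_closed)
  next
    case (insert v S)
    thus ?case
      by (simp add: bilinear_cls_add[OF assms(1) _ assms(3)] bilinear_cls_scale[OF assms(1) _ assms(3)]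
          word_polys_closed raag_gen_class)
  qed
  from this[OF finite_V subset_refl, of "\<lambda>v. word_coeff p [v]"] show ?thesis
    by (simp flip: deg1_expand[OF assms(2)])
qed

lemma gen_deg: "v \<in> V \<Longrightarrow> gen v \<in> deg A 1"
  by (auto simp: raag_deg raag_gen_class tensor_algebra_def)

abbreviation tuple_sum :: "('b::ab_group_add, 'y) cspace_scheme \<Rightarrow> ('v \<Rightarrow> 'b) \<Rightarrow> ('v raag_elem, 'b) tensor"
  where "tuple_sum M x \<equiv> tensor_sum A M V gen x"

lemma tuple_sum_in_tensors:
  assumes "\<And>v. v \<in> V \<Longrightarrow> x v \<in> vectors M"
  shows "tuple_sum M x \<in> tensors A 1 M"
proof -
  obtain h where h: "bij_betw h {0..<card V} V" using ex_bij_betw_nat_finite[OF finite_V] by blast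
  have hV: "h j \<in> V" if "j < card V" for j using h that by (auto simp: bij_betw_def)
  have "tuple_sum M x = tensor_sum A M {..<card V} (gen \<circ> h) (x \<circ> h)"
    by (rule tensor_sum_cong) (simp add: sum.reindex_bij_betw[OF h, symmetric] atLeast0LessThan)
  moreover have "\<forall>j<card V. (gen \<circ> h) j \<in> deg A 1 \<and> (x \<circ> h) j \<in> vectors M"
    using hV gen_deg assms by simp
  ultimately show ?thesis unfolding tensors_def by blast
qed

text \<open>Each degree-1 factor of a pure tensor expands in the generators; bilinearity then collects the
  coefficients at each vertex.\<close>

lemma tensors1:
  assumes "complex_subspace M" "t \<in> tensors A 1 M"
  obtains x where "\<And>v. v \<in> V \<Longrightarrow> x v \<in> vectors M" "t = tuple_sum M x"
proof -
  interpret complex_subspace M by fact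
  obtain n :: nat and a y where t: "t = tensor_sum A M {..<n} a y"
    and ay: "\<And>j. j < n \<Longrightarrow> a j \<in> deg A 1" "\<And>j. j < n \<Longrightarrow> y j \<in> vectors M"
    using assms(2) unfolding tensors_def by blast
  have "\<forall>j. \<exists>p. j < n \<longrightarrow> p \<in> deg (tensor_algebra V) 1 \<and> a j = cls p"
    using ay(1) by (auto simp: raag_deg)
  then obtain p where p: "\<And>j. j < n \<Longrightarrow> p j \<in> deg (tensor_algebra V) 1" "\<And>j. j < n \<Longrightarrow> a j = cls (p j)"
    by metis
  let ?x = "\<lambda>v. \<Sum>j<n. scale M (word_coeff (p j) [v]) (y j)"
  have "t = tuple_sum M ?x" unfolding t
  proof (rule tensor_sum_cong)
    fix \<beta> assume b: "\<beta> \<in> bilinear_forms A M"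
    have "(\<Sum>j<n. \<beta> (a j) (y j)) = (\<Sum>j<n. \<Sum>v\<in>V. word_coeff (p j) [v] * \<beta> (gen v) (y j))"
      using ay p by (intro sum.cong) (simp_all add: bilinear_deg1[OF b])
    also have "\<dots> = (\<Sum>v\<in>V. \<Sum>j<n. word_coeff (p j) [v] * \<beta> (gen v) (y j))" by (rule sum.swap)
    also have "\<dots> = (\<Sum>v\<in>V. \<beta> (gen v) (?x v))"
    proof (rule sum.cong[OF refl])
      fix v assume "v \<in> V"
      show "(\<Sum>j<n. word_coeff (p j) [v] * \<beta> (gen v) (y j)) = \<beta> (gen v) (?x v)"
        by (rule bilinear_form_sum[OF b gen_carrier[OF \<open>v \<in> V\<close>], symmetric]) (use ay(2) in simp)
    qed
    finally show "(\<Sum>j<n. \<beta> (a j) (y j)) = (\<Sum>v\<in>V. \<beta> (gen v) (?x v))" .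
  qed
  moreover have "?x v \<in> vectors M" for v using ay(2) by (intro sum_closed closed) auto
  ultimately show ?thesis using that[of ?x] by simp
qed

abbreviation unit_tensor :: "('b::ab_group_add, 'y) cspace_scheme \<Rightarrow> 'b \<Rightarrow> ('v raag_elem, 'b) tensor"
  where "unit_tensor M u \<equiv> tensor_sum A M {()} (\<lambda>_. cls 1) (\<lambda>_. u)"

lemma tensors0:
  assumes "complex_subspace M"
  shows "tensors A 0 M = unit_tensor M ` vectors M"
proof (intro Set.equalityI subsetI)
  interpret complex_subspace M by fact
  fix t assume "t \<in> tensors A 0 M"
  then obtain n :: nat and a y where t: "t = tensor_sum A M {..<n} a y"
    and ay: "\<And>j. j < n \<Longrightarrow> a j \<in> deg A 0" "\<And>j. j < n \<Longrightarrow> y j \<in> vectors M"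
    unfolding tensors_def by blast
  have "\<forall>j. \<exists>p. j < n \<longrightarrow> p \<in> deg (tensor_algebra V) 0 \<and> a j = cls p"
    using ay(1) by (auto simp: raag_deg)
  then obtain p where p: "\<And>j. j < n \<Longrightarrow> p j \<in> deg (tensor_algebra V) 0" "\<And>j. j < n \<Longrightarrow> a j = cls (p j)"
    by metis
  let ?u = "\<Sum>j<n. scale M (word_coeff (p j) []) (y j)"
  have "t = unit_tensor M ?u" unfolding t
  proof (rule tensor_sum_cong)
    fix \<beta> assume b: "\<beta> \<in> bilinear_forms A M"
    have "\<beta> (a j) (y j) = word_coeff (p j) [] * \<beta> (cls 1) (y j)" if "j < n" for j
      using bilinear_cls_scale[OF b word_polys_closed(4) ay(2), OF that, of "word_coeff (p j) []"]
      by (simp add: p[OF that] flip: deg0_expand[OF p(1)[OF that], simplified])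
    hence "(\<Sum>j<n. \<beta> (a j) (y j)) = (\<Sum>j<n. word_coeff (p j) [] * \<beta> (cls 1) (y j))"
      by simp
    also have "\<dots> = \<beta> (cls 1) ?u"
      by (rule bilinear_form_sum[OF b cls_carrier[OF word_polys_closed(4)], symmetric]) (use ay(2) in simp)
    finally show "(\<Sum>j<n. \<beta> (a j) (y j)) = (\<Sum>_\<in>{()}. \<beta> (cls 1) ?u)" by simp
  qed
  moreover have "?u \<in> vectors M" using ay(2) by (intro sum_closed closed) auto
  ultimately show "t \<in> unit_tensor M ` vectors M" by blast
next
  fix t assume "t \<in> unit_tensor M ` vectors M"
  then obtain u where u: "u \<in> vectors M" "t = unit_tensor M u" by blast
  have "t = tensor_sum A M {..<1::nat} (\<lambda>_. cls 1) (\<lambda>_. u)"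
    unfolding u by (rule tensor_sum_cong) simp
  moreover have "cls 1 \<in> deg A 0" by (auto simp: raag_deg tensor_algebra_def zero_word_def)
  ultimately show "t \<in> tensors A 0 M" unfolding tensors_def using u(1) by blast
qed

lemma tuple_sum_inject:
  assumes "complex_subspace M" "\<And>v. v \<in> V \<Longrightarrow> x v \<in> vectors M" "\<And>v. v \<in> V \<Longrightarrow> y v \<in> vectors M"
    and eq: "tuple_sum M x = tuple_sum M y" and "v \<in> V"
  shows "x v = y v"
proof (rule complex_subspace.eqI_linear_forms[OF assms(1)])
  fix f assume f: "f \<in> linear_forms M"
  obtain \<beta> where b: "\<beta> \<in> bilinear_forms A M"
    and \<beta>: "\<And>p x. p \<in> word_polys V \<Longrightarrow> \<beta> (cls p) x = word_coeff p [v] * f x"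
  proof (rule bilinear_form_of_coeff[OF _ _ _ f])
    show "word_coeff p [v] = word_coeff q [v]"
      if "p \<in> word_polys V" "q \<in> word_polys V" "cls p = cls q" for p q
      using that by (rule raag_class_eqD(1))
  qed (simp_all add: lookup_add word_coeff_mult lookup_single zero_word_def)
  have "\<beta> (gen w) z = (if w = v then f z else 0)" if "w \<in> V" for w z
    using \<beta>[OF word_polys_closed(5)[OF that]] by (simp add: raag_gen_class lookup_single when_def)
  hence "(\<Sum>w\<in>V. \<beta> (gen w) (z w)) = (\<Sum>w\<in>V. if w = v then f (z w) else 0)" for z
    by (intro sum.cong refl)
  hence "tuple_sum M z \<beta> = f (z v)" for z
    using b finite_V \<open>v \<in> V\<close> by (simp add: tensor_sum_def)
  thus "f (x v) = f (y v)" using eq by metis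
qed (use assms in auto)

text \<open>Antisymmetry is the polarization of \<open>x x = 0\<close> at \<open>x = v + w\<close>.\<close>

lemma gen_mult_antisym:
  assumes "\<beta> \<in> bilinear_forms A M" "x \<in> vectors M" "v \<in> V" "w \<in> V"
  shows "\<beta> (gen v \<otimes>\<^bsub>A\<^esub> gen w) x = - \<beta> (gen w \<otimes>\<^bsub>A\<^esub> gen v) x"
    and "{v, w} \<notin> E \<Longrightarrow> \<beta> (gen v \<otimes>\<^bsub>A\<^esub> gen w) x = 0"
proof -
  have sq: "\<beta> (cls (p * p)) x = 0" if "p \<in> deg (tensor_algebra V) 1" for p
    using raag_class_square[OF that] bilinear_cls_zero[OF assms(1) word_polys_closed(3) assms(2)] by simp
  have deg: "letter v \<in> deg (tensor_algebra V) 1" "letter w \<in> deg (tensor_algebra V) 1"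
    "letter v + letter w \<in> deg (tensor_algebra V) 1"
    using assms(3,4) Poly_Mapping.keys_add[of "letter v" "letter w"] by (auto simp: tensor_algebra_def)
  have "\<beta> (cls ((letter v + letter w) * (letter v + letter w))) x =
      \<beta> (cls (letter v * letter v)) x + \<beta> (cls (letter v * letter w)) x +
      (\<beta> (cls (letter w * letter v)) x + \<beta> (cls (letter w * letter w)) x)"
    using assms(3,4)
    by (simp add: bilinear_cls_add[OF assms(1) _ assms(2)] word_polys_closed distrib_left distrib_right)
  thus "\<beta> (gen v \<otimes>\<^bsub>A\<^esub> gen w) x = - \<beta> (gen w \<otimes>\<^bsub>A\<^esub> gen v) x"
    using sq[OF deg(1)] sq[OF deg(2)] sq[OF deg(3)] assms(3,4)
    by (simp add: gen_mult eq_neg_iff_add_eq_0)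
  show "\<beta> (gen v \<otimes>\<^bsub>A\<^esub> gen w) x = 0" if "{v, w} \<notin> E"
    using raag_class_nonadjacent[OF assms(3,4) that] assms(3,4)
      bilinear_cls_zero[OF assms(1) word_polys_closed(3) assms(2)] by (simp add: gen_mult)
qed

text \<open>An element \<open>\<Sum> v\<^sup>* w\<^sup>* \<otimes> m\<^sub>v\<^sub>w\<close> of \<open>A\<^sup>2 \<otimes> M\<close> is tested edge by edge. If \<open>m\<close> is symmetric on
  edges, swapping the summation variables shows that the sum equals its own negative; conversely the
  form with \<^const>\<open>antisym_coeff\<close> at an edge reads off \<open>m\<^sub>v\<^sub>w - m\<^sub>w\<^sub>v\<close>.\<close>

lemma degree2_vanishing_iff:
  assumes "complex_subspace M" and m: "\<And>v w. v \<in> V \<Longrightarrow> w \<in> V \<Longrightarrow> m v w \<in> vectors M"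
  shows "(\<forall>\<beta>\<in>bilinear_forms A M. (\<Sum>v\<in>V. \<Sum>w\<in>V. \<beta> (gen v \<otimes>\<^bsub>A\<^esub> gen w) (m v w)) = 0) \<longleftrightarrow>
    (\<forall>v w. {v, w} \<in> E \<longrightarrow> m v w = m w v)"
proof (intro iffI ballI allI impI)
  fix \<beta> assume sym: "\<forall>v w. {v, w} \<in> E \<longrightarrow> m v w = m w v" and b: "\<beta> \<in> bilinear_forms A M"
  let ?S = "\<Sum>v\<in>V. \<Sum>w\<in>V. \<beta> (gen v \<otimes>\<^bsub>A\<^esub> gen w) (m v w)"
  have "?S = (\<Sum>v\<in>V. \<Sum>w\<in>V. \<beta> (gen w \<otimes>\<^bsub>A\<^esub> gen v) (m w v))" by (rule sum.swap)
  also have "\<dots> = (\<Sum>v\<in>V. \<Sum>w\<in>V. - \<beta> (gen v \<otimes>\<^bsub>A\<^esub> gen w) (m v w))"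
  proof (intro sum.cong refl)
    fix v w assume vw: "v \<in> V" "w \<in> V"
    show "\<beta> (gen w \<otimes>\<^bsub>A\<^esub> gen v) (m w v) = - \<beta> (gen v \<otimes>\<^bsub>A\<^esub> gen w) (m v w)"
    proof (cases "{v, w} \<in> E")
      case True
      thus ?thesis using sym gen_mult_antisym(1)[OF b m, of v w w v] vw by metis
    next
      case False
      hence "{w, v} \<notin> E" by (simp add: insert_commute)
      thus ?thesis using False gen_mult_antisym(2)[OF b m] vw by simp
    qed
  qed
  also have "\<dots> = - ?S" by (simp add: sum_negf)
  finally show "?S = 0" by simp
next
  fix v w assume van: "\<forall>\<beta>\<in>bilinear_forms A M. (\<Sum>v\<in>V. \<Sum>w\<in>V. \<beta> (gen v \<otimes>\<^bsub>A\<^esub> gen w) (m v w)) = 0"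
    and e: "{v, w} \<in> E"
  have vw: "v \<in> V" "w \<in> V" "v \<noteq> w" using edgeD[OF e] by auto
  show "m v w = m w v"
  proof (rule complex_subspace.eqI_linear_forms[OF assms(1)])
    fix f assume f: "f \<in> linear_forms M"
    obtain \<beta> where b: "\<beta> \<in> bilinear_forms A M"
      and \<beta>: "\<And>p x. p \<in> word_polys V \<Longrightarrow> \<beta> (cls p) x = antisym_coeff p v w * f x"
    proof (rule bilinear_form_of_coeff[OF _ _ _ f])
      show "antisym_coeff p v w = antisym_coeff q v w"
        if "p \<in> word_polys V" "q \<in> word_polys V" "cls p = cls q" for p q
        using that e by (rule raag_class_eqD(2))
    qed (simp_all add: antisym_coeff_def lookup_add word_coeff_mult lookup_single zero_word_def algebra_simps)
    have "\<beta> (gen a \<otimes>\<^bsub>A\<^esub> gen b) z =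
        (if a = v then if b = w then f z else 0 else 0) - (if a = w then if b = v then f z else 0 else 0)"
      if "a \<in> V" "b \<in> V" for a b z
      using that \<beta>[OF word_polys_closed(2)[OF word_polys_closed(5) word_polys_closed(5)], of a b] vw(3)
      by (auto simp: gen_mult antisym_coeff_def word_coeff_mult lookup_single when_def)
    hence "(\<Sum>a\<in>V. \<Sum>b\<in>V. \<beta> (gen a \<otimes>\<^bsub>A\<^esub> gen b) (m a b)) =
      (\<Sum>a\<in>V. \<Sum>b\<in>V. (if a = v then if b = w then f (m a b) else 0 else 0)
         - (if a = w then if b = v then f (m a b) else 0 else 0))"
      by (intro sum.cong refl) simp
    also have "\<dots> = (\<Sum>a\<in>V. if a = v then f (m a w) else 0) - (\<Sum>a\<in>V. if a = w then f (m a v) else 0)"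
    proof -
      have "(\<Sum>b\<in>V. if a = v then if b = w then f (m a b) else 0 else 0) = (if a = v then f (m a w) else 0)"
        "(\<Sum>b\<in>V. if a = w then if b = v then f (m a b) else 0 else 0) = (if a = w then f (m a v) else 0)" for a
        using finite_V vw by simp_all
      thus ?thesis by (simp add: sum_subtractf)
    qed
    also have "\<dots> = f (m v w) - f (m w v)" using finite_V vw by simp
    finally show "f (m v w) = f (m w v)" using van b by simp
  qed (use m vw in auto)
qed

end

section \<open>Flat connections and twisted cohomology\<close>

lemma word_poly_scalar_central:
  fixes p :: "'v word \<Rightarrow>\<^sub>0 complex"
  shows "p * Poly_Mapping.single 0 c = Poly_Mapping.single 0 c * p"
proof (rule poly_mapping_eqI)
  fix w :: "'v word"
  obtain l where w: "w = Word l" by (cases w)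
  have "word_coeff (p * Poly_Mapping.single 0 c) l =
      (\<Sum>i\<le>length l. if i = length l then word_coeff p l * c else 0)"
    unfolding lookup_mult_word by (rule sum.cong) (auto simp: lookup_single zero_word_def when_def)
  moreover have "word_coeff (Poly_Mapping.single 0 c * p) l =
      (\<Sum>i\<le>length l. if i = 0 then c * word_coeff p l else 0)"
    unfolding lookup_mult_word by (rule sum.cong) (auto simp: lookup_single zero_word_def when_def)
  ultimately show "Poly_Mapping.lookup (p * Poly_Mapping.single 0 c) w =
      Poly_Mapping.lookup (Poly_Mapping.single 0 c * p) w"
    by (simp add: w)
qed

definition linear_between ::
  "('b::ab_group_add, 'y) cspace_scheme \<Rightarrow> ('c::ab_group_add, 'z) cspace_scheme \<Rightarrow> ('b \<Rightarrow> 'c) \<Rightarrow> bool" where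
  "linear_between N M h \<longleftrightarrow> (\<forall>x\<in>vectors N. h x \<in> vectors M) \<and>
    (\<forall>x\<in>vectors N. \<forall>y\<in>vectors N. h (x + y) = h x + h y) \<and>
    (\<forall>c. \<forall>x\<in>vectors N. h (scale N c x) = scale M c (h x))"

context raag_graph
begin

lemma
  assumes "a \<in> carrier A" "b \<in> carrier A"
  shows mult_carrier: "a \<otimes>\<^bsub>A\<^esub> b \<in> carrier A"
    and add_carrier: "a \<oplus>\<^bsub>A\<^esub> b \<in> carrier A"
    and smult_carrier: "c \<odot>\<^bsub>A\<^esub> a \<in> carrier A"
    and smult_mult: "(c \<odot>\<^bsub>A\<^esub> a) \<otimes>\<^bsub>A\<^esub> b = c \<odot>\<^bsub>A\<^esub> (a \<otimes>\<^bsub>A\<^esub> b)"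
    and mult_smult: "a \<otimes>\<^bsub>A\<^esub> (c \<odot>\<^bsub>A\<^esub> b) = c \<odot>\<^bsub>A\<^esub> (a \<otimes>\<^bsub>A\<^esub> b)"
    and mult_distrib_left: "d \<in> carrier A \<Longrightarrow> d \<otimes>\<^bsub>A\<^esub> (a \<oplus>\<^bsub>A\<^esub> b) = (d \<otimes>\<^bsub>A\<^esub> a) \<oplus>\<^bsub>A\<^esub> (d \<otimes>\<^bsub>A\<^esub> b)"
    and mult_distrib_right: "d \<in> carrier A \<Longrightarrow> (a \<oplus>\<^bsub>A\<^esub> b) \<otimes>\<^bsub>A\<^esub> d = (a \<otimes>\<^bsub>A\<^esub> d) \<oplus>\<^bsub>A\<^esub> (b \<otimes>\<^bsub>A\<^esub> d)"
proof -
  obtain p q where pq: "a = cls p" "b = cls q" "p \<in> word_polys V" "q \<in> word_polys V"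
    using assms unfolding raag_carrier by blast
  note simps = pq raag_mult raag_add raag_smult word_polys_closed cls_carrier
  have "p * (Poly_Mapping.single 0 c * q) = Poly_Mapping.single 0 c * (p * q)"
    using word_poly_scalar_central[of p c] by (simp flip: mult.assoc)
  thus "a \<otimes>\<^bsub>A\<^esub> (c \<odot>\<^bsub>A\<^esub> b) = c \<odot>\<^bsub>A\<^esub> (a \<otimes>\<^bsub>A\<^esub> b)" by (simp add: simps)
  show "a \<otimes>\<^bsub>A\<^esub> b \<in> carrier A" "a \<oplus>\<^bsub>A\<^esub> b \<in> carrier A" "c \<odot>\<^bsub>A\<^esub> a \<in> carrier A"
    "(c \<odot>\<^bsub>A\<^esub> a) \<otimes>\<^bsub>A\<^esub> b = c \<odot>\<^bsub>A\<^esub> (a \<otimes>\<^bsub>A\<^esub> b)"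
    by (simp_all add: simps mult.assoc)
  assume "d \<in> carrier A"
  then obtain r where r: "d = cls r" "r \<in> word_polys V" unfolding raag_carrier by blast
  show "d \<otimes>\<^bsub>A\<^esub> (a \<oplus>\<^bsub>A\<^esub> b) = (d \<otimes>\<^bsub>A\<^esub> a) \<oplus>\<^bsub>A\<^esub> (d \<otimes>\<^bsub>A\<^esub> b)"
    "(a \<oplus>\<^bsub>A\<^esub> b) \<otimes>\<^bsub>A\<^esub> d = (a \<otimes>\<^bsub>A\<^esub> d) \<oplus>\<^bsub>A\<^esub> (b \<otimes>\<^bsub>A\<^esub> d)"
    by (simp_all add: simps r distrib_left distrib_right)
qed

text \<open>Multiplication by a fixed element is linear on either side; on the right this uses that scalars are
  central.\<close>

lemma bilinear_pullback:
  assumes b: "\<beta> \<in> bilinear_forms A M" and c: "c \<in> carrier A" and h: "linear_between N M h"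
  shows "(\<lambda>a x. \<beta> (c \<otimes>\<^bsub>A\<^esub> a) (h x)) \<in> bilinear_forms A N"
    and "(\<lambda>a x. \<beta> (a \<otimes>\<^bsub>A\<^esub> c) (h x)) \<in> bilinear_forms A N"
  using h c unfolding linear_between_def bilinear_forms_def[of A N]
  by (auto simp: bilinear_formsD[OF b] mult_carrier smult_carrier smult_mult mult_smult
      mult_distrib_left mult_distrib_right)

lemma bilinear_forms_sum:
  assumes "\<And>i. i \<in> I \<Longrightarrow> \<beta> i \<in> bilinear_forms A N"
  shows "(\<lambda>a x. \<Sum>i\<in>I. \<beta> i a x) \<in> bilinear_forms A N"
  using assms unfolding bilinear_forms_def
  by (auto simp: sum.distrib sum_distrib_left intro!: sum.cong)

lemma bilinear_forms_cong:
  assumes "complex_subspace N" "\<beta> \<in> bilinear_forms A N"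
    and eq: "\<And>a x. a \<in> carrier A \<Longrightarrow> x \<in> vectors N \<Longrightarrow> \<gamma> a x = \<beta> a x"
  shows "\<gamma> \<in> bilinear_forms A N"
  using complex_subspace.closed[OF assms(1)]
  unfolding bilinear_forms_def
  by (auto simp: eq bilinear_formsD[OF assms(2)] add_carrier smult_carrier)

text \<open>The common computation behind the bracket of \<open>A \<otimes> \<gg>\<close> and the twisted differential: both pair two
  tensors along a bilinear operation of the coefficients. As a function of the outer
  argument, the inner pairing agrees with a bilinear form only on the carriers, hence the transfer by \<open>bilinear_forms_cong\<close>.\<close>

lemma product_tensor_eval:
  assumes "complex_subspace N" and b: "\<beta> \<in> bilinear_forms A M"
    and op: "\<And>y. y \<in> vectors P \<Longrightarrow> linear_between N M (\<lambda>x. op x y)"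
      "\<And>x. x \<in> vectors N \<Longrightarrow> linear_between P M (op x)"
    and \<omega>: "\<And>v. v \<in> V \<Longrightarrow> \<omega> v \<in> vectors N"
    and c: "\<And>j. j \<in> J \<Longrightarrow> c j \<in> carrier A" and u: "\<And>j. j \<in> J \<Longrightarrow> u j \<in> vectors P"
  shows "tuple_sum N \<omega> (\<lambda>a x. tensor_sum A P J c u (\<lambda>b y. \<beta> (a \<otimes>\<^bsub>A\<^esub> b) (op x y))) =
    (\<Sum>v\<in>V. \<Sum>j\<in>J. \<beta> (gen v \<otimes>\<^bsub>A\<^esub> c j) (op (\<omega> v) (u j)))"
proof -
  let ?\<gamma> = "\<lambda>a x. tensor_sum A P J c u (\<lambda>b y. \<beta> (a \<otimes>\<^bsub>A\<^esub> b) (op x y))"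
  have eq: "?\<gamma> a x = (\<Sum>j\<in>J. \<beta> (a \<otimes>\<^bsub>A\<^esub> c j) (op x (u j)))" if "a \<in> carrier A" "x \<in> vectors N" for a x
    using bilinear_pullback(1)[OF b that(1) op(2)[OF that(2)]] by (simp add: tensor_sum_def)
  have "(\<lambda>a x. \<Sum>j\<in>J. \<beta> (a \<otimes>\<^bsub>A\<^esub> c j) (op x (u j))) \<in> bilinear_forms A N"
    by (rule bilinear_forms_sum, rule bilinear_pullback(2)[OF b c op(1)[OF u]])
  hence "?\<gamma> \<in> bilinear_forms A N" by (rule bilinear_forms_cong[OF assms(1)]) (rule eq)
  thus ?thesis by (simp add: tensor_sum_def[of A N] eq gen_carrier \<omega>)
qed

lemma zero_diff_eval:
  assumes "\<beta> \<in> bilinear_forms A M" "\<And>j. j \<in> J \<Longrightarrow> u j \<in> vectors M"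
  shows "tensor_sum A M J c u (\<lambda>a x. \<beta> (diff A a) x) = 0"
  using assms bilinear_cls_zero[OF assms(1) word_polys_closed(3)]
  by (simp add: tensor_sum_def raag_diff)

end

text \<open>A quotient space is zero iff the subspace is everything; stated for the classes of the relation
  restricted to \<open>Z\<close>, where the zero class is \<open>B\<close>.\<close>

lemma quotient_by_difference_iff:
  fixes Z B :: "('x \<Rightarrow> complex) set"
  assumes "B \<subseteq> Z" "(\<lambda>_. 0) \<in> B" "\<And>t u. t \<in> B \<Longrightarrow> u \<in> B \<Longrightarrow> (\<lambda>x. t x - u x) \<in> B"
  shows "Z // {(t, u). t \<in> Z \<and> u \<in> Z \<and> (\<lambda>x. t x - u x) \<in> B} \<noteq> {B} \<longleftrightarrow> \<not> Z \<subseteq> B"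
    (is "Z // ?R \<noteq> _ \<longleftrightarrow> _")
proof -
  have cls: "?R `` {t} = {u \<in> Z. (\<lambda>x. t x - u x) \<in> B}" if "t \<in> Z" for t using that by auto
  show ?thesis
  proof (intro iffI notI)
    assume ne: "Z // ?R \<noteq> {B}" and "Z \<subseteq> B"
    hence ZB: "Z = B" using assms(1) by blast
    hence "?R `` {t} = B" if "t \<in> Z" for t unfolding cls[OF that] using that assms(3) by blast
    hence "Z // ?R = {B}" unfolding quotient_def using ZB assms(2) by auto
    thus False using ne by simp
  next
    assume "\<not> Z \<subseteq> B" and eq: "Z // ?R = {B}"
    then obtain t where t: "t \<in> Z" "t \<notin> B" by blast
    have "?R `` {t} \<in> Z // ?R" using t(1) by (rule quotientI)
    hence "?R `` {t} = B" using eq by simp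
    moreover have "t \<in> ?R `` {t}" unfolding cls[OF t(1)] using t(1) assms(2) by simp
    ultimately show False using t(2) by simp
  qed
qed

locale raag_module = raag_graph V E for V :: "'v set" and E +
  fixes \<gg> :: "'g::ab_group_add lie_algebra" and s :: "complex \<Rightarrow> 'u::ab_group_add \<Rightarrow> 'u"
    and \<theta> :: "'g \<Rightarrow> 'u \<Rightarrow> 'u"
  assumes g_space: "complex_subspace \<gg>"
    and bracket_linear: "x \<in> vectors \<gg> \<Longrightarrow> linear_between \<gg> \<gg> (bracket \<gg> x)"
    and bracket_antisym: "bracket \<gg> x y = - bracket \<gg> y x"
    and module_space: "vector_space s"
    and lie_module: "lie_module \<gg> s \<theta>"
begin

lemma no_2_torsion:
  fixes x :: 'g
  assumes "x + x = 0"
  shows "x = 0"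
proof -
  interpret vector_space "scale \<gg>" by (rule complex_subspace.ambient[OF g_space])
  have "scale \<gg> 2 x = scale \<gg> (1 + 1) x" by simp
  also have "\<dots> = 0" unfolding scale_left_distrib using assms by simp
  finally show ?thesis by simp
qed

abbreviation U :: "'u cspace" where "U \<equiv> full_space s"

lemma U_simps: "vectors U = UNIV" "scale U = s" by (simp_all add: full_space_def)

lemma U_space: "complex_subspace U"
proof -
  interpret vector_space s by (rule module_space)
  show ?thesis by (rule complex_subspace.intro) (simp_all add: U_simps vector_space_axioms)
qed

lemma action_linear: "x \<in> vectors \<gg> \<Longrightarrow> Vector_Spaces.linear s s (\<theta> x)"
  using lie_module unfolding lie_module_def by blast

lemma action_simps:
  assumes "x \<in> vectors \<gg>"
  shows "\<theta> x (a + b) = \<theta> x a + \<theta> x b" "\<theta> x (a - b) = \<theta> x a - \<theta> x b" "\<theta> x 0 = 0"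
    "\<theta> x (s c a) = s c (\<theta> x a)" "\<theta> (scale \<gg> c x) a = s c (\<theta> x a)"
    and "y \<in> vectors \<gg> \<Longrightarrow> \<theta> (x + y) a = \<theta> x a + \<theta> y a"
    and "y \<in> vectors \<gg> \<Longrightarrow> \<theta> (bracket \<gg> x y) a = \<theta> x (\<theta> y a) - \<theta> y (\<theta> x a)"
proof -
  interpret Vector_Spaces.linear s s "\<theta> x" using assms by (rule action_linear)
  show "\<theta> x (a + b) = \<theta> x a + \<theta> x b" "\<theta> x (a - b) = \<theta> x a - \<theta> x b" "\<theta> x 0 = 0"
    "\<theta> x (s c a) = s c (\<theta> x a)"
    by (simp_all add: add diff zero scale)
  show "\<theta> (scale \<gg> c x) a = s c (\<theta> x a)"
    "y \<in> vectors \<gg> \<Longrightarrow> \<theta> (x + y) a = \<theta> x a + \<theta> y a"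
    "y \<in> vectors \<gg> \<Longrightarrow> \<theta> (bracket \<gg> x y) a = \<theta> x (\<theta> y a) - \<theta> y (\<theta> x a)"
    using lie_module assms unfolding lie_module_def by blast+
qed

lemma action_linear_between:
  "linear_between \<gg> U (\<lambda>x. \<theta> x a)" "x \<in> vectors \<gg> \<Longrightarrow> linear_between U U (\<theta> x)"
  by (auto simp: linear_between_def U_simps action_simps)

lemma bracket_linear_left:
  assumes "y \<in> vectors \<gg>"
  shows "linear_between \<gg> \<gg> (\<lambda>x. bracket \<gg> x y)"
proof -
  interpret complex_subspace \<gg> by (rule g_space)
  interpret vector_space "scale \<gg>" by (rule ambient)
  have "linear_between \<gg> \<gg> (\<lambda>x. - bracket \<gg> y x)"
    using bracket_linear[OF assms] closed(3)[OF closed(1)] unfolding linear_between_def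
    by (auto simp: scale_minus_right)
  thus ?thesis by (simp add: bracket_antisym[of _ y] linear_between_def)
qed

lemma flat_connection_iff:
  assumes \<omega>: "\<And>v. v \<in> V \<Longrightarrow> \<omega> v \<in> vectors \<gg>"
  shows "tuple_sum \<gg> \<omega> \<in> flat_connections A \<gg> \<longleftrightarrow>
    (\<forall>v w. {v, w} \<in> E \<longrightarrow> bracket \<gg> (\<omega> v) (\<omega> w) = 0)"
proof -
  let ?S = "\<lambda>\<beta>. \<Sum>v\<in>V. \<Sum>w\<in>V. \<beta> (gen v \<otimes>\<^bsub>A\<^esub> gen w) (bracket \<gg> (\<omega> v) (\<omega> w))"
  have br: "bracket \<gg> (\<omega> v) (\<omega> w) \<in> vectors \<gg>" if "v \<in> V" "w \<in> V" for v w
    using bracket_linear[OF \<omega>] \<omega> that by (auto simp: linear_between_def)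
  have "tensor_diff A \<gg> (tuple_sum \<gg> \<omega>) \<beta> = 0" for \<beta>
    using zero_diff_eval[of \<beta> \<gg> V \<omega> gen] \<omega> by (simp add: tensor_diff_def)
  moreover have "tensor_bracket A \<gg> (tuple_sum \<gg> \<omega>) (tuple_sum \<gg> \<omega>) \<beta> =
      (if \<beta> \<in> bilinear_forms A \<gg> then ?S \<beta> else 0)" for \<beta>
    using product_tensor_eval[OF g_space _ bracket_linear_left bracket_linear, of \<beta> \<omega> V gen \<omega>] \<omega>
    by (simp add: tensor_bracket_def gen_carrier)
  ultimately have "tuple_sum \<gg> \<omega> \<in> flat_connections A \<gg> \<longleftrightarrow> (\<forall>\<beta>\<in>bilinear_forms A \<gg>. ?S \<beta> = 0)"
    using tuple_sum_in_tensors[OF \<omega>] by (auto simp: flat_connections_def fun_eq_iff)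
  also have "\<dots> \<longleftrightarrow> (\<forall>v w. {v, w} \<in> E \<longrightarrow> bracket \<gg> (\<omega> v) (\<omega> w) = bracket \<gg> (\<omega> w) (\<omega> v))"
    using degree2_vanishing_iff[OF g_space br] .
  also have "\<dots> \<longleftrightarrow> (\<forall>v w. {v, w} \<in> E \<longrightarrow> bracket \<gg> (\<omega> v) (\<omega> w) = 0)"
  proof -
    have "bracket \<gg> (\<omega> v) (\<omega> w) = bracket \<gg> (\<omega> w) (\<omega> v) \<longleftrightarrow> bracket \<gg> (\<omega> v) (\<omega> w) = 0" for v w
      using no_2_torsion[of "bracket \<gg> (\<omega> v) (\<omega> w)"] bracket_antisym[of "\<omega> v" "\<omega> w"]
        bracket_antisym[of "\<omega> w" "\<omega> v"]
      by (metis add.right_inverse neg_equal_0_iff_equal)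
    thus ?thesis by simp
  qed
  finally show ?thesis .
qed

definition cocycle :: "('v \<Rightarrow> 'g) \<Rightarrow> ('v \<Rightarrow> 'u) \<Rightarrow> bool" where
  "cocycle \<omega> u \<longleftrightarrow> (\<forall>v w. {v, w} \<in> E \<longrightarrow> \<theta> (\<omega> v) (u w) = \<theta> (\<omega> w) (u v))"

lemma cocycles_eq:
  assumes \<omega>: "\<And>v. v \<in> V \<Longrightarrow> \<omega> v \<in> vectors \<gg>"
  shows "cocycles1 A s \<theta> (tuple_sum \<gg> \<omega>) = tuple_sum U ` {u. cocycle \<omega> u}"
proof -
  have "twisted_diff A s \<theta> (tuple_sum \<gg> \<omega>) (tuple_sum U u) = (\<lambda>_. 0) \<longleftrightarrow> cocycle \<omega> u" for u
  proof -
    let ?S = "\<lambda>\<beta>. \<Sum>v\<in>V. \<Sum>w\<in>V. \<beta> (gen v \<otimes>\<^bsub>A\<^esub> gen w) (\<theta> (\<omega> v) (u w))"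
    have "twisted_diff A s \<theta> (tuple_sum \<gg> \<omega>) (tuple_sum U u) =
        (\<lambda>\<beta>. if \<beta> \<in> bilinear_forms A U then ?S \<beta> else 0)"
      using product_tensor_eval[OF g_space _ action_linear_between, of _ \<omega> V gen u] \<omega>
        zero_diff_eval[of _ U V u gen]
      by (auto simp: twisted_diff_def gen_carrier U_simps fun_eq_iff)
    hence "twisted_diff A s \<theta> (tuple_sum \<gg> \<omega>) (tuple_sum U u) = (\<lambda>_. 0) \<longleftrightarrow>
        (\<forall>\<beta>\<in>bilinear_forms A U. ?S \<beta> = 0)"
      by (auto simp: fun_eq_iff)
    also have "\<dots> \<longleftrightarrow> cocycle \<omega> u" unfolding cocycle_def
      by (rule degree2_vanishing_iff[OF U_space]) (simp add: U_simps)
    finally show ?thesis .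
  qed
  moreover have "tensors A 1 U = range (tuple_sum U)"
  proof (intro Set.equalityI subsetI)
    fix t assume "t \<in> tensors A 1 U"
    then obtain u where "t = tuple_sum U u" by (rule tensors1[OF U_space])
    thus "t \<in> range (tuple_sum U)" by blast
  qed (use tuple_sum_in_tensors[of _ U] in \<open>auto simp: U_simps simp del: One_nat_def\<close>)
  ultimately show ?thesis unfolding cocycles1_def by (auto simp del: One_nat_def)
qed

lemma coboundaries_eq:
  assumes \<omega>: "\<And>v. v \<in> V \<Longrightarrow> \<omega> v \<in> vectors \<gg>"
  shows "coboundaries1 A s \<theta> (tuple_sum \<gg> \<omega>) = range (\<lambda>x. tuple_sum U (\<lambda>v. \<theta> (\<omega> v) x))"
proof -
  have "twisted_diff A s \<theta> (tuple_sum \<gg> \<omega>) (unit_tensor U x) = tuple_sum U (\<lambda>v. \<theta> (\<omega> v) x)" for x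
  proof
    fix \<beta>
    have "gen v \<otimes>\<^bsub>A\<^esub> cls 1 = gen v" if "v \<in> V" for v
      using that by (simp add: raag_gen_class raag_mult word_polys_closed)
    thus "twisted_diff A s \<theta> (tuple_sum \<gg> \<omega>) (unit_tensor U x) \<beta> = tuple_sum U (\<lambda>v. \<theta> (\<omega> v) x) \<beta>"
      using product_tensor_eval[OF g_space _ action_linear_between, of \<beta> \<omega> "{()}" "\<lambda>_. cls 1" "\<lambda>_. x"] \<omega>
        zero_diff_eval[of \<beta> U "{()}" "\<lambda>_. x" "\<lambda>_. cls 1"]
      by (simp add: twisted_diff_def cls_carrier word_polys_closed U_simps tensor_sum_def[of A U V])
  qed
  thus ?thesis unfolding coboundaries1_def tensors0[OF U_space] by (auto simp: U_simps image_image)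
qed

text \<open>Flatness makes coboundaries cocycles, so the cohomology is a genuine quotient and is non-zero iff
  some cocycle is not a coboundary.\<close>

theorem resonance_iff:
  assumes \<omega>: "\<And>v. v \<in> V \<Longrightarrow> \<omega> v \<in> vectors \<gg>"
  shows "tuple_sum \<gg> \<omega> \<in> resonance_variety A \<gg> s \<theta> \<longleftrightarrow>
    (\<forall>v w. {v, w} \<in> E \<longrightarrow> bracket \<gg> (\<omega> v) (\<omega> w) = 0) \<and>
    (\<exists>u. cocycle \<omega> u \<and> (\<nexists>x. \<forall>v\<in>V. u v = \<theta> (\<omega> v) x))"
proof (cases "tuple_sum \<gg> \<omega> \<in> flat_connections A \<gg>")
  case False
  thus ?thesis using flat_connection_iff[of \<omega>, OF \<omega>] by (auto simp: resonance_variety_def)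
next
  case True
  hence flat: "bracket \<gg> (\<omega> v) (\<omega> w) = 0" if "{v, w} \<in> E" for v w
    using that flat_connection_iff[of \<omega>, OF \<omega>] by blast
  let ?Z = "cocycles1 A s \<theta> (tuple_sum \<gg> \<omega>)" and ?B = "coboundaries1 A s \<theta> (tuple_sum \<gg> \<omega>)"
  interpret g: complex_subspace \<gg> by (rule g_space)
  interpret gv: vector_space "scale \<gg>" by (rule g.ambient)
  have zero: "\<theta> 0 a = 0" for a
    using action_simps(6)[OF g.closed(1) g.closed(1), of a] by simp
  have BZ: "?B \<subseteq> ?Z"
  proof -
    have "cocycle \<omega> (\<lambda>v. \<theta> (\<omega> v) x)" for x
      unfolding cocycle_def
    proof (intro allI impI)
      fix v w assume e: "{v, w} \<in> E"
      hence "v \<in> V" "w \<in> V" using edgeD by auto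
      hence "\<theta> (bracket \<gg> (\<omega> v) (\<omega> w)) x = \<theta> (\<omega> v) (\<theta> (\<omega> w) x) - \<theta> (\<omega> w) (\<theta> (\<omega> v) x)"
        using action_simps(7)[OF \<omega> \<omega>] by blast
      thus "\<theta> (\<omega> v) (\<theta> (\<omega> w) x) = \<theta> (\<omega> w) (\<theta> (\<omega> v) x)" using flat[OF e] zero by simp
    qed
    thus ?thesis by (auto simp: cocycles_eq[of \<omega>, OF \<omega>] coboundaries_eq[of \<omega>, OF \<omega>])
  qed
  have diff: "(\<lambda>\<beta>. t \<beta> - u \<beta>) \<in> ?B" if tu: "t \<in> ?B" "u \<in> ?B" for t u
  proof -
    obtain x y where xy: "t = tuple_sum U (\<lambda>v. \<theta> (\<omega> v) x)" "u = tuple_sum U (\<lambda>v. \<theta> (\<omega> v) y)"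
      using tu by (auto simp: coboundaries_eq[of \<omega>, OF \<omega>])
    have "\<beta> (gen v) (\<theta> (\<omega> v) x) - \<beta> (gen v) (\<theta> (\<omega> v) y) = \<beta> (gen v) (\<theta> (\<omega> v) (x - y))"
      if "v \<in> V" "\<beta> \<in> bilinear_forms A U" for v \<beta>
      using bilinear_formsD(2)[OF that(2) gen_carrier[OF that(1)], of "\<theta> (\<omega> v) (x - y)" "\<theta> (\<omega> v) y"] \<omega>[OF that(1)]
      by (simp add: U_simps action_simps)
    hence "(\<lambda>\<beta>. t \<beta> - u \<beta>) = tuple_sum U (\<lambda>v. \<theta> (\<omega> v) (x - y))"
      unfolding xy by (auto simp: tensor_sum_def sum_subtractf[symmetric] intro!: sum.cong)
    thus ?thesis by (auto simp: coboundaries_eq[of \<omega>, OF \<omega>])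
  qed
  have "tuple_sum U (\<lambda>v. \<theta> (\<omega> v) 0) \<in> ?B"
    by (auto simp: coboundaries_eq[of \<omega>, OF \<omega>])
  from diff[OF this this] have "(\<lambda>_. 0) \<in> ?B" by simp
  from quotient_by_difference_iff[OF BZ this diff]
  have "tuple_sum \<gg> \<omega> \<in> resonance_variety A \<gg> s \<theta> \<longleftrightarrow> \<not> ?Z \<subseteq> ?B"
    unfolding resonance_variety_def cohomology1_def using True by blast
  also have "\<dots> \<longleftrightarrow> (\<exists>u. cocycle \<omega> u \<and> (\<nexists>x. \<forall>v\<in>V. u v = \<theta> (\<omega> v) x))"
  proof -
    have "tuple_sum U u = tuple_sum U u' \<longleftrightarrow> (\<forall>v\<in>V. u v = u' v)" for u u'
    proof
      show "tuple_sum U u = tuple_sum U u'" if "\<forall>v\<in>V. u v = u' v"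
        by (rule tensor_sum_cong) (use that in \<open>simp cong: sum.cong\<close>)
      show "\<forall>v\<in>V. u v = u' v" if "tuple_sum U u = tuple_sum U u'"
        using tuple_sum_inject[OF U_space _ _ that] by (simp add: U_simps)
    qed
    moreover have "?Z = tuple_sum U ` {u. cocycle \<omega> u}" by (rule cocycles_eq) (rule \<omega>)
    moreover have "?B = range (\<lambda>x. tuple_sum U (\<lambda>v. \<theta> (\<omega> v) x))" by (rule coboundaries_eq) (rule \<omega>)
    ultimately show ?thesis by (simp add: image_subset_iff image_iff)
  qed
  finally show ?thesis using flat by blast
qed

lemma resonance_is_tuple:
  assumes "t \<in> resonance_variety A \<gg> s \<theta>"
  shows "\<exists>\<omega>. (\<forall>v\<in>V. \<omega> v \<in> vectors \<gg>) \<and> t = tuple_sum \<gg> \<omega>"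
proof -
  have "t \<in> tensors A 1 \<gg>" using assms by (simp add: resonance_variety_def flat_connections_def)
  from tensors1[OF g_space this] show ?thesis by metis
qed

end

section \<open>Determinants and spans of rank at most one\<close>

text \<open>In coordinates with respect to the chosen basis, the kernel of \<open>f\<close> is the kernel of its matrix.\<close>

lemma endo_det_eq_0_iff:
  fixes s :: "complex \<Rightarrow> 'u::ab_group_add \<Rightarrow> 'u"
  assumes "vector_space s" and fin: "\<exists>B. finite B \<and> Modules.module.span s B = UNIV"
    and f: "Vector_Spaces.linear s s f"
  shows "endo_det s f = 0 \<longleftrightarrow> \<not> inj f"
proof -
  interpret vector_space s by fact
  interpret f: Vector_Spaces.linear s s f by fact
  define bs where "bs = (SOME bs. distinct bs \<and> independent (set bs) \<and> span (set bs) = UNIV)"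
  have "\<exists>bs. distinct bs \<and> independent (set bs) \<and> span (set bs) = UNIV"
  proof -
    obtain B0 where B0: "finite B0" "span B0 = UNIV" using fin by blast
    obtain B where B: "B \<subseteq> B0" "independent B" "B0 \<subseteq> span B"
      using maximal_independent_subset[of B0] by blast
    have "span B = UNIV" using B(3) B0(2) span_mono[OF B(3)] by (auto simp: span_span)
    moreover obtain bs where "set bs = B" "distinct bs"
      using finite_distinct_list finite_subset[OF B(1) B0(1)] by blast
    ultimately show ?thesis using B(2) by blast
  qed
  hence bs: "distinct bs" "independent (set bs)" "span (set bs) = UNIV"
    unfolding bs_def by (rule someI2_ex; blast)+
  define n where "n = length bs"
  let ?rep = "representation (set bs)"
  define M where "M = Matrix.mat n n (\<lambda>(i, j). ?rep (f (bs ! j)) (bs ! i))"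
  have det: "endo_det s f = Determinant.det M"
    unfolding endo_det_def M_def n_def bs_def by (simp add: Let_def)
  have M: "M \<in> carrier_mat n n" by (simp add: M_def)
  define lc where "lc c = (\<Sum>j<n. s (c j) (bs ! j))" for c
  have sum_rep: "lc (\<lambda>j. ?rep x (bs ! j)) = x" for x
  proof -
    have "lc (\<lambda>j. ?rep x (bs ! j)) = (\<Sum>b\<in>set bs. s (?rep x b) b)"
      unfolding lc_def n_def
      by (rule sum.reindex_bij_betw[OF bij_betw_nth[OF bs(1) refl refl]])
    thus ?thesis using bs by (simp add: sum_representation_eq)
  qed
  have rep_sum: "?rep (\<Sum>j<n. s (c j) (v j)) b = (\<Sum>j<n. c j * ?rep (v j) b)" for c v b
    using bs by (simp add: representation_sum representation_scale)
  have rep_lc: "?rep (lc c) (bs ! i) = c i" if "i < n" for c i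
  proof -
    have "?rep (lc c) (bs ! i) = (\<Sum>j<n. if j = i then c j else 0)"
      unfolding lc_def rep_sum
      using bs that by (intro sum.cong) (auto simp: representation_basis nth_eq_iff_index_eq n_def)
    thus ?thesis using that by simp
  qed
  have rep_f: "?rep (f (lc c)) (bs ! i) = vec_index (M *\<^sub>v Matrix.vec n c) i" if "i < n" for c i
    using that unfolding lc_def
    by (simp add: f.sum f.scale rep_sum M_def scalar_prod_def atLeast0LessThan mult.commute)
  have ext: "x = 0" if "\<And>i. i < n \<Longrightarrow> ?rep x (bs ! i) = 0" for x
  proof -
    have "lc (\<lambda>j. ?rep x (bs ! j)) = 0" unfolding lc_def using that by simp
    thus ?thesis by (simp add: sum_rep)
  qed
  have kernel: "f (lc c) = 0 \<longleftrightarrow> M *\<^sub>v Matrix.vec n c = 0\<^sub>v n" for c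
  proof
    assume "f (lc c) = 0"
    thus "M *\<^sub>v Matrix.vec n c = 0\<^sub>v n"
      using rep_f[of _ c] M by (intro eq_vecI) (simp_all add: representation_zero)
  next
    assume "M *\<^sub>v Matrix.vec n c = 0\<^sub>v n"
    thus "f (lc c) = 0" using rep_f[of _ c] by (intro ext) simp
  qed
  have "endo_det s f = 0 \<longleftrightarrow> (\<exists>x. x \<noteq> 0 \<and> f x = 0)"
  proof
    assume "endo_det s f = 0"
    then obtain v where v: "v \<in> carrier_vec n" "v \<noteq> 0\<^sub>v n" "M *\<^sub>v v = 0\<^sub>v n"
      using det_0_iff_vec_prod_zero[OF M] det by auto
    have eq: "Matrix.vec n (vec_index v) = v" using v(1) by (intro eq_vecI) auto
    hence "f (lc (vec_index v)) = 0" using kernel v(3) by simp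
    moreover have "lc (vec_index v) \<noteq> 0"
    proof
      assume "lc (vec_index v) = 0"
      hence "vec_index v i = 0" if "i < n" for i using rep_lc[OF that, of "vec_index v"] by (simp add: representation_zero)
      thus False using v(1,2) by (metis eq_vecI carrier_vecD index_zero_vec)
    qed
    ultimately show "\<exists>x. x \<noteq> 0 \<and> f x = 0" by blast
  next
    assume "\<exists>x. x \<noteq> 0 \<and> f x = 0"
    then obtain x where x: "x \<noteq> 0" "f x = 0" by blast
    let ?v = "Matrix.vec n (\<lambda>j. ?rep x (bs ! j))"
    have "M *\<^sub>v ?v = 0\<^sub>v n" using kernel[of "\<lambda>j. ?rep x (bs ! j)"] x(2) by (simp add: sum_rep)
    moreover have "?v \<noteq> 0\<^sub>v n"
    proof
      assume *: "?v = 0\<^sub>v n"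
      have "?rep x (bs ! i) = 0" if "i < n" for i
        using arg_cong[OF *, of "\<lambda>w. vec_index w i"] that by simp
      thus False using ext x(1) by blast
    qed
    ultimately show "endo_det s f = 0" using det_0_iff_vec_prod_zero[OF M] det vec_carrier by metis
  qed
  also have "\<dots> \<longleftrightarrow> \<not> inj f" using f.inj_iff_eq_0 by blast
  finally show ?thesis .
qed

lemma inj_iff_surj_finite_dim:
  fixes s :: "complex \<Rightarrow> 'u::ab_group_add \<Rightarrow> 'u"
  assumes "vector_space s" and fin: "\<exists>B. finite B \<and> Modules.module.span s B = UNIV"
    and f: "Vector_Spaces.linear s s f"
  shows "inj f \<longleftrightarrow> surj f"
proof -
  interpret vector_space s by fact
  obtain B0 where B0: "finite B0" "span B0 = UNIV" using fin by blast
  obtain B where B: "B \<subseteq> B0" "independent B" "B0 \<subseteq> span B"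
    using maximal_independent_subset[of B0] by blast
  have "span B = UNIV" using B(3) B0(2) span_mono[OF B(3)] by (auto simp: span_span)
  then interpret finite_dimensional_vector_space s B
    using B finite_subset[OF B(1) B0(1)] by unfold_locales auto
  show ?thesis using linear_inj_imp_surj[OF f] linear_surj_imp_inj[OF f] by blast
qed

lemma (in vector_space) dim_span_le_1_iff:
  assumes "finite S"
  shows "dim (span S) \<le> 1 \<longleftrightarrow> (\<exists>g. S \<subseteq> span {g})"
proof
  assume d: "dim (span S) \<le> 1"
  show "\<exists>g. S \<subseteq> span {g}"
  proof -
    obtain B where B: "B \<subseteq> S" "independent B" "S \<subseteq> span B" "card B = dim S"
      using basis_exists[of S] by blast
    have "finite B" using B(1) assms finite_subset by blast
    moreover have "card B \<le> 1" using d B(4) by (simp add: dim_span)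
    ultimately have "B = {} \<or> (\<exists>g. B = {g})"
      by (metis One_nat_def card_0_eq card_1_singletonE le_SucE le_zero_eq)
    then obtain g where "B \<subseteq> {g}" by blast
    hence "S \<subseteq> span {g}" using subset_trans[OF B(3) span_mono] by simp
    thus ?thesis ..
  qed
next
  assume "\<exists>g. S \<subseteq> span {g}"
  then obtain g where "S \<subseteq> span {g}" by blast
  hence "dim S \<le> card {g}" by (rule dim_le_card) simp
  thus "dim (span S) \<le> 1" by (simp add: dim_span)
qed

section \<open>Commuting elements of \<open>sl\<^sub>2\<close>\<close>

lemma vector_space_matrix: "vector_space (\<lambda>c. map_matrix ((*) c) :: complex^2^2 \<Rightarrow> complex^2^2)"
  by unfold_locales (simp_all add: map_matrix_def Finite_Cartesian_Product.vec_eq_iff algebra_simps)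

lemma trace_0_lower_right:
  fixes x :: "complex^2^2"
  assumes "trace x = 0"
  shows "x $ 2 $ 2 = - (x $ 1 $ 1)"
  using assms by (simp add: trace_def sum_2 eq_neg_iff_add_eq_0 add.commute)

text \<open>The entries of the commutator are, up to factors, the components of the cross product of the
  coordinate vectors \<open>(a, b, d)\<close> of the two matrices.\<close>

lemma sl2_commuting:
  fixes x y :: "complex^2^2"
  assumes "trace x = 0" "trace y = 0" "x ** y - y ** x = 0" "x \<noteq> 0"
  shows "\<exists>c. y = map_matrix ((*) c) x"
proof -
  define a b d where abd: "a = x $ 1 $ 1" "b = x $ 1 $ 2" "d = x $ 2 $ 1"
  define a' b' d' where abd': "a' = y $ 1 $ 1" "b' = y $ 1 $ 2" "d' = y $ 2 $ 1"
  have x22: "x $ 2 $ 2 = - a" "y $ 2 $ 2 = - a'" using trace_0_lower_right assms(1,2) abd(1) abd'(1) by auto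
  have "\<forall>i j::2. (x ** y) $ i $ j = (y ** x) $ i $ j" using assms(3) by simp
  hence "b * d' = b' * d" "a * b' + a * b' = a' * b + a' * b" "a * d' + a * d' = a' * d + a' * d"
    by (simp_all add: forall_2 matrix_matrix_mult_def sum_2 x22 flip: abd abd')
  hence eqs: "b * d' = b' * d" "a * b' = a' * b" "a * d' = a' * d" by simp_all
  have scaled: "y = map_matrix ((*) c) x" if "a' = c * a" "b' = c * b" "d' = c * d" for c
    using that x22 by (simp add: map_matrix_def Finite_Cartesian_Product.vec_eq_iff forall_2 flip: abd abd')
  have "a \<noteq> 0 \<or> b \<noteq> 0 \<or> d \<noteq> 0"
    using assms(4) x22 by (auto simp: Finite_Cartesian_Product.vec_eq_iff forall_2 simp flip: abd abd')
  then consider "a \<noteq> 0" | "b \<noteq> 0" | "d \<noteq> 0" by blast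
  thus ?thesis
  proof cases
    case 1
    thus ?thesis using eqs by (intro exI[of _ "a' / a"] scaled) (simp_all add: field_simps)
  next
    case 2
    thus ?thesis using eqs by (intro exI[of _ "b' / b"] scaled) (simp_all add: field_simps)
  next
    case 3
    thus ?thesis using eqs by (intro exI[of _ "d' / d"] scaled) (simp_all add: field_simps)
  qed
qed

lemma sl2_sol2_simps:
  assumes "\<gg> = sl2 \<or> \<gg> = sol2"
  shows "scale \<gg> = (\<lambda>c. map_matrix ((*) c))" "bracket \<gg> = (\<lambda>x y. x ** y - y ** x)"
    "x \<in> vectors \<gg> \<Longrightarrow> trace x = 0"
  using assms by (auto simp: sl2_def sol2_def)

lemma complex_subspace_sl2_sol2:
  assumes "\<gg> = sl2 \<or> \<gg> = sol2"
  shows "complex_subspace \<gg>"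
proof (rule complex_subspace.intro)
  show vs: "vector_space (scale \<gg>)" using vector_space_matrix sl2_sol2_simps(1)[OF assms] by simp
  interpret vector_space "scale \<gg>" by (rule vs)
  have "trace (map_matrix ((*) c) x) = c * trace x" for c and x :: "complex^2^2"
    by (simp add: trace_def sum_2 map_matrix_def distrib_left)
  moreover have "trace (0 :: complex^2^2) = 0" by (simp add: trace_def)
  moreover have "map_matrix ((*) c) x $ 2 $ 1 = c * x $ 2 $ 1" for c and x :: "complex^2^2"
    by (simp add: map_matrix_def)
  ultimately show "subspace (vectors \<gg>)" unfolding subspace_def unfolding sl2_sol2_simps(1)[OF assms]
    using assms by (auto simp: sl2_def sol2_def trace_add)
qed

lemma bracket_linear_sl2_sol2:
  assumes "\<gg> = sl2 \<or> \<gg> = sol2" "x \<in> vectors \<gg>"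
  shows "linear_between \<gg> \<gg> (bracket \<gg> x)"
  unfolding linear_between_def sl2_sol2_simps(1,2)[OF assms(1)]
proof (intro conjI ballI allI)
  fix y assume "y \<in> vectors \<gg>"
  thus "x ** y - y ** x \<in> vectors \<gg>"
    using assms by (auto simp: sl2_def sol2_def trace_def sum_2 matrix_matrix_mult_def algebra_simps)
qed (simp_all add: Finite_Cartesian_Product.vec_eq_iff forall_2 matrix_matrix_mult_def sum_2 map_matrix_def algebra_simps)

section \<open>Connected components of induced subgraphs\<close>

lemma components_iff: "C \<in> components E W \<longleftrightarrow> (\<exists>x\<in>W. C = (induced_adj E W)\<^sup>* `` {x})"
  by (auto simp: components_def quotient_def)

lemma sym_reachable: "sym ((induced_adj E W)\<^sup>*)"
  by (rule sym_rtrancl) (auto simp: sym_def induced_adj_def insert_commute)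

lemma reachable_closed: "(x, y) \<in> (induced_adj E W)\<^sup>* \<Longrightarrow> x \<in> W \<Longrightarrow> y \<in> W"
  by (induction rule: rtrancl_induct) (auto simp: induced_adj_def)

lemma component_subset: "C \<in> components E W \<Longrightarrow> C \<subseteq> W"
  using reachable_closed by (fastforce simp: components_iff)

lemma component_nonempty: "C \<in> components E W \<Longrightarrow> C \<noteq> {}"
  by (auto simp: components_iff)

lemma components_disjoint:
  assumes "C \<in> components E W" "D \<in> components E W" "x \<in> C" "x \<in> D"
  shows "C = D"
proof -
  let ?R = "(induced_adj E W)\<^sup>*"
  obtain c d where cd: "C = ?R `` {c}" "D = ?R `` {d}" using assms(1,2) by (auto simp: components_iff)
  hence "(c, x) \<in> ?R" "(d, x) \<in> ?R" using assms by auto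
  moreover from this have "(x, c) \<in> ?R" "(x, d) \<in> ?R" using sym_reachable[of E W] by (auto dest: symD)
  ultimately have "(c, d) \<in> ?R" "(d, c) \<in> ?R" by (blast intro: rtrancl_trans)+
  thus ?thesis unfolding cd by (auto intro: rtrancl_trans)
qed

lemma component_edge_closed:
  assumes "C \<in> components E W" "v \<in> C" "w \<in> W" "{v, w} \<in> E"
  shows "w \<in> C"
proof -
  have "(v, w) \<in> induced_adj E W"
    using assms component_subset by (auto simp: induced_adj_def)
  thus ?thesis using assms by (auto simp: components_iff intro: rtrancl.rtrancl_into_rtrancl)
qed

lemma finite_components: "finite W \<Longrightarrow> finite (components E W)"
  by (rule finite_subset[of _ "Pow W"]) (use component_subset in blast, simp)

lemma in_component: "x \<in> W \<Longrightarrow> \<exists>C\<in>components E W. x \<in> C"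
  by (rule bexI[of _ "(induced_adj E W)\<^sup>* `` {x}"]) (auto simp: components_iff)

lemma one_component:
  assumes "num_components E W = 1"
  shows "components E W = {W}"
proof -
  obtain C where C: "components E W = {C}" using assms unfolding num_components_def by (metis card_1_singletonE)
  moreover have "C = W" using in_component[of _ W E] component_subset[of C E W] C by auto
  ultimately show ?thesis by simp
qed

lemma several_components:
  assumes "num_components E W > 1"
  obtains C D where "C \<in> components E W" "D \<in> components E W" "C \<inter> D = {}"
proof -
  have card: "\<not> card (components E W) \<le> Suc 0" using assms by (simp add: num_components_def)
  hence "0 < card (components E W)" by linarith
  hence "finite (components E W)" by (rule card_ge_0_finite)
  with card
  obtain C D where "C \<in> components E W" "D \<in> components E W" "C \<noteq> D"
    by (auto simp: card_le_Suc0_iff_eq)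
  thus ?thesis using that components_disjoint by (metis disjoint_iff)
qed

lemma num_components_gt_1:
  assumes "finite W" "C \<in> components E W" "D \<in> components E W" "C \<noteq> D"
  shows "num_components E W > 1"
  using assms card_le_Suc0_iff_eq[OF finite_components[OF assms(1), of E]]
  unfolding num_components_def by fastforce

section \<open>The resonance variety\<close>

text \<open>The theorem rests on two properties: centralizers of non-zero elements are lines, which holds for
  \<open>sl\<^sub>2\<close> and \<open>sol\<^sub>2\<close>, and the module is finite-dimensional, so that \<open>\<theta>(g)\<close> is injective iff
  it is surjective.\<close>

locale rank_one_raag_module = raag_module V E \<gg> s \<theta>
  for V :: "'v set" and E and \<gg> :: "'g::ab_group_add lie_algebra"
    and s :: "complex \<Rightarrow> 'u::ab_group_add \<Rightarrow> 'u" and \<theta> +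
  assumes commuting: "\<lbrakk>x \<in> vectors \<gg>; y \<in> vectors \<gg>; x \<noteq> 0; bracket \<gg> x y = 0\<rbrakk> \<Longrightarrow>
      \<exists>c. y = scale \<gg> c x"
    and finite_dim: "\<exists>B. finite B \<and> Modules.module.span s B = UNIV"
    and nonzero_module: "\<exists>u :: 'u. u \<noteq> 0"
begin

sublocale g: complex_subspace \<gg> by (rule g_space)

sublocale gv: vector_space "scale \<gg>" by (rule g.ambient)

sublocale uv: vector_space s by (rule module_space)

lemma action_zero: "\<theta> 0 a = 0"
  using action_simps(6)[OF g.closed(1) g.closed(1), of a] by simp

lemma inj_action_iff: "x \<in> vectors \<gg> \<Longrightarrow> inj (\<theta> x) \<longleftrightarrow> surj (\<theta> x)"
  by (rule inj_iff_surj_finite_dim[OF module_space finite_dim action_linear])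

lemma det_action_iff: "x \<in> vectors \<gg> \<Longrightarrow> endo_det s (\<theta> x) = 0 \<longleftrightarrow> \<not> surj (\<theta> x)"
  using endo_det_eq_0_iff[OF module_space finite_dim action_linear] inj_action_iff by simp

lemma bracket_collinear:
  assumes "g \<in> vectors \<gg>"
  shows "bracket \<gg> (scale \<gg> a g) (scale \<gg> b g) = 0"
proof -
  have lin: "bracket \<gg> x (scale \<gg> c y) = scale \<gg> c (bracket \<gg> x y)"
    if "x \<in> vectors \<gg>" "y \<in> vectors \<gg>" for x y c
    using bracket_linear[OF that(1)] that(2) unfolding linear_between_def by blast
  have "bracket \<gg> g g + bracket \<gg> g g = 0"
    using bracket_antisym[of g g] by (metis add.right_inverse)
  hence "bracket \<gg> g g = 0" by (rule no_2_torsion)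
  hence "bracket \<gg> g (scale \<gg> a g) = 0" using lin[OF assms assms] by simp
  hence "bracket \<gg> (scale \<gg> a g) g = 0" using bracket_antisym[of "scale \<gg> a g" g] by simp
  thus ?thesis using lin[OF g.closed(4)[OF assms] assms] by simp
qed

text \<open>The coefficients \<open>c\<close> can be taken not identically zero: if \<open>\<omega>\<close> vanishes on \<open>C\<close>, choose \<open>g = 0\<close>
  and \<open>c = 1\<close>; otherwise let \<open>g\<close> be a non-zero value of \<open>\<omega>\<close>.\<close>

lemma collinear_normal_form:
  assumes "C \<noteq> {}" and \<omega>: "\<And>v. v \<in> C \<Longrightarrow> \<omega> v \<in> vectors \<gg>" and span: "\<omega> ` C \<subseteq> gv.span {h}"
  shows "\<exists>g\<in>vectors \<gg> \<inter> gv.span {h}. \<exists>c. (\<exists>v0\<in>C. c v0 \<noteq> 0) \<and> (\<forall>v\<in>C. \<omega> v = scale \<gg> (c v) g)"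
proof (cases "\<exists>v0\<in>C. \<omega> v0 \<noteq> 0")
  case False
  hence "\<forall>v\<in>C. \<omega> v = scale \<gg> 1 0" by simp
  moreover have "0 \<in> vectors \<gg> \<inter> gv.span {h}" using g.closed(1) gv.span_zero by blast
  moreover have "\<exists>v0\<in>C. (1::complex) \<noteq> 0" using assms(1) by auto
  ultimately show ?thesis by (intro bexI[of _ 0] exI[of _ "\<lambda>_. 1"] conjI)
next
  case True
  then obtain v0 where v0: "v0 \<in> C" "\<omega> v0 \<noteq> 0" by blast
  have "\<forall>v\<in>C. \<exists>k. \<omega> v = scale \<gg> k h" using span by (auto simp: gv.span_singleton)
  then obtain k where k: "\<And>v. v \<in> C \<Longrightarrow> \<omega> v = scale \<gg> (k v) h" by metis
  have k0: "k v0 \<noteq> 0" using v0 k by fastforce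
  have "\<omega> v = scale \<gg> (k v / k v0) (\<omega> v0)" if "v \<in> C" for v
    using k[OF that] k[OF v0(1)] k0 by simp
  moreover have "\<omega> v0 \<in> vectors \<gg> \<inter> gv.span {h}" using span \<omega> v0(1) by blast
  moreover have "\<exists>v\<in>C. k v / k v0 \<noteq> 0" using k0 by (intro bexI[OF _ v0(1)]) simp
  ultimately show ?thesis
    by (intro bexI[of _ "\<omega> v0"] exI[of _ "\<lambda>v. k v / k v0"] conjI ballI)
qed

lemma bracket_zero_on_edges:
  assumes "W \<subseteq> V" and \<omega>: "\<And>v. v \<in> V \<Longrightarrow> \<omega> v \<in> vectors \<gg>" and off: "\<And>v. v \<in> V - W \<Longrightarrow> \<omega> v = 0"
    and col: "\<And>C. C \<in> components E W \<Longrightarrow> \<exists>h. \<omega> ` C \<subseteq> gv.span {h}"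
    and e: "{v, w} \<in> E"
  shows "bracket \<gg> (\<omega> v) (\<omega> w) = 0"
proof -
  have vw: "v \<in> V" "w \<in> V" using edgeD[OF e] by auto
  have right: "bracket \<gg> x 0 = 0" if "x \<in> vectors \<gg>" for x
    using bracket_linear[OF that] g.closed(1) unfolding linear_between_def
    by (metis add_cancel_right_right)
  show ?thesis
  proof (cases "v \<in> W \<and> w \<in> W")
    case True
    then obtain C where C: "C \<in> components E W" "v \<in> C" using in_component by metis
    hence "w \<in> C" using component_edge_closed[OF C _ e] True by blast
    obtain h where "\<omega> ` C \<subseteq> gv.span {h}" using col[OF C(1)] by blast
    moreover have "\<omega> v \<in> vectors \<gg>" if "v \<in> C" for v
      using \<omega> that component_subset[OF C(1)] assms(1) by blast
    ultimately obtain g c where "g \<in> vectors \<gg>" "\<And>v. v \<in> C \<Longrightarrow> \<omega> v = scale \<gg> (c v) g"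
      using collinear_normal_form[OF component_nonempty[OF C(1)], of \<omega> h] by blast
    thus ?thesis using C(2) \<open>w \<in> C\<close> bracket_collinear by simp
  next
    case False
    hence "\<omega> v = 0 \<or> \<omega> w = 0" using off vw by blast
    thus ?thesis using right \<omega> vw bracket_antisym[of 0 "\<omega> w"] by auto
  qed
qed

definition component_cochain :: "'v set \<Rightarrow> ('v \<Rightarrow> complex) \<Rightarrow> 'u \<Rightarrow> 'v \<Rightarrow> 'u" where
  "component_cochain C c x v = (if v \<in> C then s (c v) x else 0)"

text \<open>Inside \<open>C\<close> both sides of the cocycle condition are \<open>c\<^sub>v c\<^sub>w \<theta>(g) x\<close>; a neighbour of \<open>C\<close> that is
  not in \<open>C\<close> is not in \<open>W\<close> either, so \<open>\<omega>\<close> vanishes there.\<close>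

lemma cocycle_component_cochain:
  assumes "W \<subseteq> V" and off: "\<And>v. v \<in> V - W \<Longrightarrow> \<omega> v = 0" and C: "C \<in> components E W"
    and g: "g \<in> vectors \<gg>" and form: "\<And>v. v \<in> C \<Longrightarrow> \<omega> v = scale \<gg> (c v) g"
    and \<omega>: "\<And>v. v \<in> V \<Longrightarrow> \<omega> v \<in> vectors \<gg>"
  shows "cocycle \<omega> (component_cochain C c x)"
  unfolding cocycle_def
proof (intro allI impI)
  fix v w assume e: "{v, w} \<in> E"
  hence vw: "v \<in> V" "w \<in> V" using edgeD by auto
  have half: "\<theta> (\<omega> v) (component_cochain C c x w) = 0" if "v \<notin> C" "{v, w} \<in> E" "v \<in> V" "w \<in> V" for v w
  proof (cases "w \<in> C")
    case True
    hence "v \<notin> W" using component_edge_closed[OF C True _ ] that by (auto simp: insert_commute)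
    thus ?thesis using off that action_zero by simp
  next
    case False
    thus ?thesis using \<omega> that by (simp add: component_cochain_def action_simps)
  qed
  consider "v \<in> C" "w \<in> C" | "v \<notin> C" | "w \<notin> C" by blast
  thus "\<theta> (\<omega> v) (component_cochain C c x w) = \<theta> (\<omega> w) (component_cochain C c x v)"
  proof cases
    case 1
    thus ?thesis using g by (simp add: component_cochain_def form action_simps mult.commute)
  next
    case 2
    thus ?thesis using half[OF 2 e vw] \<omega>[OF vw(2)]
      by (simp add: component_cochain_def action_simps)
  next
    case 3
    thus ?thesis using half[OF 3 _ vw(2,1)] e \<omega>[OF vw(1)]
      by (simp add: component_cochain_def action_simps insert_commute)
  qed
qed

lemma coboundary_on_component:
  assumes "g \<in> vectors \<gg>" "\<omega> v = scale \<gg> (c v) g" "c v \<noteq> 0" "s (c v) x = \<theta> (\<omega> v) z"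
  shows "x = \<theta> g z"
  using assms by (simp add: action_simps)

text \<open>Here \<open>g\<close> in the normal form is a multiple of the given singular \<open>h\<close>, possibly zero, so \<open>\<theta>(g)\<close> is
  still not surjective, and an \<open>x\<close> outside its image gives a non-trivial class.\<close>

lemma P_subset:
  assumes W: "W \<subseteq> V" "num_components E W = 1"
  shows "P_set V E \<gg> s \<theta> W \<subseteq> resonance_variety A \<gg> s \<theta>"
proof
  fix t assume "t \<in> P_set V E \<gg> s \<theta> W"
  then obtain \<omega> h c where t: "t = tuple_sum \<gg> \<omega>" and off: "\<And>v. v \<in> V - W \<Longrightarrow> \<omega> v = 0"
    and h: "h \<in> vectors \<gg>" "endo_det s (\<theta> h) = 0" and form: "\<And>v. v \<in> W \<Longrightarrow> \<omega> v = scale \<gg> (c v) h"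
    unfolding P_set_def tuple_tensor_def by blast
  have \<omega>: "\<omega> v \<in> vectors \<gg>" if "v \<in> V" for v
    using that off[of v] form[of v] g.closed(1) g.closed(4)[OF h(1)] by (cases "v \<in> W") auto
  have comp: "components E W = {W}" by (rule one_component[OF W(2)])
  have WC: "W \<in> components E W" using comp by simp
  have span: "\<omega> ` W \<subseteq> gv.span {h}" using form by (auto simp: gv.span_singleton)
  have \<omega>W: "\<omega> v \<in> vectors \<gg>" if "v \<in> W" for v using \<omega> that W(1) by blast
  obtain g c' v0 where g: "g \<in> vectors \<gg>" "v0 \<in> W" "c' v0 \<noteq> 0"
      "\<And>v. v \<in> W \<Longrightarrow> \<omega> v = scale \<gg> (c' v) g" "g \<in> gv.span {h}"
    using collinear_normal_form[OF component_nonempty[OF WC] \<omega>W span] by blast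
  obtain k where k: "g = scale \<gg> k h" using g(5) by (auto simp: gv.span_singleton)
  have "range (\<theta> g) \<subseteq> range (\<theta> h)"
    unfolding k using h(1) by (auto simp: action_simps(5)) (metis action_simps(4) rangeI)
  moreover have "\<not> surj (\<theta> h)" using det_action_iff h by blast
  ultimately obtain x where x: "x \<notin> range (\<theta> g)" by blast
  have "cocycle \<omega> (component_cochain W c' x)"
    by (rule cocycle_component_cochain[OF W(1) off WC g(1)]) (use g(4) \<omega> in auto)
  moreover have "\<nexists>z. \<forall>v\<in>V. component_cochain W c' x v = \<theta> (\<omega> v) z"
  proof
    assume "\<exists>z. \<forall>v\<in>V. component_cochain W c' x v = \<theta> (\<omega> v) z"
    then obtain z where "component_cochain W c' x v0 = \<theta> (\<omega> v0) z" using g(2) W(1) by blast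
    hence "s (c' v0) x = \<theta> (\<omega> v0) z" using g(2) by (simp add: component_cochain_def)
    hence "x = \<theta> g z" by (rule coboundary_on_component[of g \<omega> v0 c', OF g(1) g(4)[OF g(2)] g(3)])
    thus False using x by blast
  qed
  moreover have "bracket \<gg> (\<omega> v) (\<omega> w) = 0" if "{v, w} \<in> E" for v w
    by (rule bracket_zero_on_edges[of W \<omega>, OF W(1) \<omega> off _ that]) (use comp span in auto)
  ultimately show "t \<in> resonance_variety A \<gg> s \<theta>" unfolding t using resonance_iff[of \<omega>] \<omega> by blast
qed

text \<open>If all cocycles supported on \<open>C\<close> are coboundaries then \<open>\<theta>(g)\<close> is surjective, hence injective; a
  primitive of a cocycle supported on \<open>D\<close> is in the kernel of \<open>\<theta>(g)\<close>, hence zero.\<close>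

lemma S_subset:
  assumes W: "W \<subseteq> V" "num_components E W > 1"
  shows "S_set V E \<gg> W \<subseteq> resonance_variety A \<gg> s \<theta>"
proof
  fix t assume "t \<in> S_set V E \<gg> W"
  then obtain \<omega> where t: "t = tuple_sum \<gg> \<omega>" and off: "\<And>v. v \<in> V - W \<Longrightarrow> \<omega> v = 0"
    and \<omega>: "\<And>v. v \<in> V \<Longrightarrow> \<omega> v \<in> vectors \<gg>"
    and dim: "\<And>C. C \<in> components E W \<Longrightarrow> gv.dim (gv.span (\<omega> ` C)) \<le> 1"
    unfolding S_set_def tuple_tensor_def by blast
  have col: "\<exists>h. \<omega> ` C \<subseteq> gv.span {h}" if "C \<in> components E W" for C
  proof -
    have "finite C" using component_subset[OF that] W(1) finite_V by (meson finite_subset)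
    thus ?thesis using dim[OF that] gv.dim_span_le_1_iff by simp
  qed
  have nf: "\<exists>g c v0. g \<in> vectors \<gg> \<and> v0 \<in> C \<and> c v0 \<noteq> 0 \<and> (\<forall>v\<in>C. \<omega> v = scale \<gg> (c v) g)"
    if C: "C \<in> components E W" for C
  proof -
    obtain h where "\<omega> ` C \<subseteq> gv.span {h}" using col[OF C] by blast
    moreover have "\<omega> v \<in> vectors \<gg>" if "v \<in> C" for v
      using \<omega> that component_subset[OF C] W(1) by blast
    ultimately show ?thesis
      using collinear_normal_form[OF component_nonempty[OF C], of \<omega> h] by blast
  qed
  obtain C D where CD: "C \<in> components E W" "D \<in> components E W" "C \<inter> D = {}"
    by (rule several_components[OF W(2)])
  obtain g c v where g: "g \<in> vectors \<gg>" "v \<in> C" "c v \<noteq> 0" "\<And>v. v \<in> C \<Longrightarrow> \<omega> v = scale \<gg> (c v) g"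
    using nf[OF CD(1)] by blast
  obtain h d w where h: "h \<in> vectors \<gg>" "w \<in> D" "d w \<noteq> 0" "\<And>v. v \<in> D \<Longrightarrow> \<omega> v = scale \<gg> (d v) h"
    using nf[OF CD(2)] by blast
  have vw: "v \<in> V" "w \<in> V" "v \<notin> D" "w \<notin> C"
    using g(2) h(2) CD component_subset[of C E W] component_subset[of D E W] W(1) by auto
  have bracket: "bracket \<gg> (\<omega> v) (\<omega> w) = 0" if "{v, w} \<in> E" for v w
    by (rule bracket_zero_on_edges[of W \<omega>, OF W(1) \<omega> off col that])
  have coc: "cocycle \<omega> (component_cochain C c x)" "cocycle \<omega> (component_cochain D d x)" for x
    by (rule cocycle_component_cochain[OF W(1) off CD(1) g(1)]; use g(4) \<omega> in auto)
       (rule cocycle_component_cochain[OF W(1) off CD(2) h(1)]; use h(4) \<omega> in auto)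
  show "t \<in> resonance_variety A \<gg> s \<theta>"
  proof (rule ccontr)
    assume "t \<notin> resonance_variety A \<gg> s \<theta>"
    hence cob: "\<exists>z. \<forall>v\<in>V. u v = \<theta> (\<omega> v) z" if "cocycle \<omega> u" for u
      using that bracket resonance_iff[of \<omega>] \<omega> unfolding t by blast
    have on_C: "\<exists>z. x = \<theta> g z" for x
    proof -
      obtain z where "\<forall>v\<in>V. component_cochain C c x v = \<theta> (\<omega> v) z" using cob[OF coc(1)] by blast
      hence "component_cochain C c x v = \<theta> (\<omega> v) z" using vw(1) by blast
      hence "s (c v) x = \<theta> (\<omega> v) z" using g(2) by (simp add: component_cochain_def)
      thus ?thesis using coboundary_on_component[of g \<omega> v c, OF g(1) g(4)[OF g(2)] g(3)] by blast
    qed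
    hence "surj (\<theta> g)" by (metis surjI)
    hence inj: "inj (\<theta> g)" using inj_action_iff[OF g(1)] by simp
    obtain y :: 'u where "y \<noteq> 0" using nonzero_module by blast
    obtain z where z: "\<forall>v\<in>V. component_cochain D d y v = \<theta> (\<omega> v) z" using cob[OF coc(2)] by blast
    hence zvw: "component_cochain D d y v = \<theta> (\<omega> v) z" "component_cochain D d y w = \<theta> (\<omega> w) z"
      using vw by blast+
    have "s (d w) y = \<theta> (\<omega> w) z" using zvw(2) h(2) by (simp add: component_cochain_def)
    hence y: "y = \<theta> h z" by (rule coboundary_on_component[of h \<omega> w d, OF h(1) h(4)[OF h(2)] h(3)])
    have "s (c v) 0 = \<theta> (\<omega> v) z" using zvw(1) vw(3) by (simp add: component_cochain_def)
    hence "0 = \<theta> g z" by (rule coboundary_on_component[of g \<omega> v c, OF g(1) g(4)[OF g(2)] g(3)])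
    hence "z = 0" using inj action_simps(3)[OF g(1)] by (metis injD)
    thus False using y \<open>y \<noteq> 0\<close> action_simps(3)[OF h(1)] by simp
  qed
qed

text \<open>Each edge of \<open>W\<close> joins two non-zero commuting, hence proportional, vectors. The value at a vertex that
  is isolated in \<open>W\<close> may be zero, which the strata with an added isolated vertex need.\<close>

lemma reachable_collinear:
  assumes flat: "\<And>v w. {v, w} \<in> E \<Longrightarrow> bracket \<gg> (\<omega> v) (\<omega> w) = 0"
    and \<omega>: "\<And>v. v \<in> V \<Longrightarrow> \<omega> v \<in> vectors \<gg>"
    and nz: "\<And>v w. (v, w) \<in> induced_adj E W \<Longrightarrow> \<omega> v \<noteq> 0"
    and "(x, y) \<in> (induced_adj E W)\<^sup>*"
  shows "\<omega> y \<in> gv.span {\<omega> x}"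
  using assms(4)
proof (induction rule: rtrancl_induct)
  case (step y z)
  hence e: "{y, z} \<in> E" by (simp add: induced_adj_def)
  obtain c where "\<omega> z = scale \<gg> c (\<omega> y)"
    using commuting[OF \<omega> \<omega> nz[OF step(2)] flat[OF e]] edgeD[OF e] by blast
  thus ?case using step.IH by (simp add: gv.span_scale)
qed (simp add: gv.span_base)

lemma tuple_in_S:
  assumes flat: "\<And>v w. {v, w} \<in> E \<Longrightarrow> bracket \<gg> (\<omega> v) (\<omega> w) = 0"
    and \<omega>: "\<And>v. v \<in> V \<Longrightarrow> \<omega> v \<in> vectors \<gg>"
    and nz: "\<And>v w. (v, w) \<in> induced_adj E W \<Longrightarrow> \<omega> v \<noteq> 0"
    and "W \<subseteq> V" "\<And>v. v \<in> V - W \<Longrightarrow> \<omega> v = 0"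
  shows "tuple_sum \<gg> \<omega> \<in> S_set V E \<gg> W"
proof -
  have "gv.dim (gv.span (\<omega> ` C)) \<le> 1" if C: "C \<in> components E W" for C
  proof -
    obtain x where "C = (induced_adj E W)\<^sup>* `` {x}" using C by (auto simp: components_iff)
    moreover have "\<omega> y \<in> gv.span {\<omega> x}" if "(x, y) \<in> (induced_adj E W)\<^sup>*" for y
      by (rule reachable_collinear[OF flat \<omega> nz that])
    ultimately have "\<omega> ` C \<subseteq> gv.span {\<omega> x}" by blast
    moreover have "finite (\<omega> ` C)"
      using finite_subset[OF component_subset[OF C]] finite_subset[OF assms(4) finite_V] by blast
    ultimately show ?thesis using gv.dim_span_le_1_iff by blast
  qed
  thus ?thesis unfolding S_set_def tuple_tensor_def using assms(5) \<omega> by blast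
qed

text \<open>Choose \<open>x\<close> with \<open>u = \<theta>(\<omega>) x\<close> at one vertex of \<open>W\<close>. Along an edge \<open>{y, z}\<close> of \<open>W\<close> the cocycle
  condition and flatness give \<open>\<theta>(\<omega>\<^sub>y) u\<^sub>z = \<theta>(\<omega>\<^sub>z) \<theta>(\<omega>\<^sub>y) x = \<theta>(\<omega>\<^sub>y) \<theta>(\<omega>\<^sub>z) x\<close>, and \<open>\<theta>(\<omega>\<^sub>y)\<close>
  is injective. At a vertex outside \<open>W\<close> the edge to \<open>W\<close> forces \<open>u = 0\<close>.\<close>

lemma cocycle_coboundary_if_invertible:
  assumes flat: "\<And>v w. {v, w} \<in> E \<Longrightarrow> bracket \<gg> (\<omega> v) (\<omega> w) = 0"
    and \<omega>: "\<And>v. v \<in> V \<Longrightarrow> \<omega> v \<in> vectors \<gg>"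
    and W: "W \<subseteq> V" "components E W = {W}" "\<And>v. v \<in> V - W \<Longrightarrow> \<omega> v = 0"
    and adj: "\<And>v. v \<in> V - W \<Longrightarrow> \<exists>w\<in>W. {v, w} \<in> E"
    and inj: "\<And>w. w \<in> W \<Longrightarrow> inj (\<theta> (\<omega> w))"
    and u: "cocycle \<omega> u"
  shows "\<exists>x. \<forall>v\<in>V. u v = \<theta> (\<omega> v) x"
proof -
  have uE: "\<theta> (\<omega> v) (u w) = \<theta> (\<omega> w) (u v)" if "{v, w} \<in> E" for v w using u that unfolding cocycle_def by blast
  have "W \<in> components E W" using W(2) by simp
  then obtain w0 where w0: "w0 \<in> W" "W = (induced_adj E W)\<^sup>* `` {w0}" by (auto simp: components_iff)
  have "surj (\<theta> (\<omega> w0))" using inj_action_iff[OF \<omega>] inj w0(1) W(1) by blast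
  then obtain x where x: "u w0 = \<theta> (\<omega> w0) x" by (metis surjD)
  have onW: "u w = \<theta> (\<omega> w) x" if "(w0, w) \<in> (induced_adj E W)\<^sup>*" for w
    using that
  proof (induction rule: rtrancl_induct)
    case (step y z)
    hence e: "{y, z} \<in> E" and yz: "y \<in> W" "z \<in> W" by (simp_all add: induced_adj_def)
    hence mem: "\<omega> y \<in> vectors \<gg>" "\<omega> z \<in> vectors \<gg>" using W(1) \<omega> by auto
    have "\<theta> (\<omega> y) (u z) = \<theta> (\<omega> z) (\<theta> (\<omega> y) x)" using uE[OF e] step.IH by simp
    also have "\<dots> = \<theta> (\<omega> y) (\<theta> (\<omega> z) x)"
      using action_simps(7)[OF mem, of x] flat[OF e] action_zero by simp
    finally show ?case using inj[OF yz(1)] by (simp add: inj_def)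
  qed (rule x)
  have "u v = \<theta> (\<omega> v) x" if "v \<in> V" for v
  proof (cases "v \<in> W")
    case True
    hence "(w0, v) \<in> (induced_adj E W)\<^sup>*" using w0(2) by blast
    thus ?thesis by (rule onW)
  next
    case False
    then obtain w where w: "w \<in> W" "{v, w} \<in> E" using adj \<open>v \<in> V\<close> by blast
    have v0: "\<omega> v = 0" using W(3) \<open>v \<in> V\<close> False by blast
    hence "\<theta> (\<omega> w) (u v) = 0" using uE[OF w(2)] action_zero by simp
    also have "0 = \<theta> (\<omega> w) 0" using action_simps(3)[OF \<omega>] w(1) W(1) by (metis subset_iff)
    finally have "u v = 0" using inj[OF w(1)] by (simp add: inj_def)
    thus ?thesis using v0 action_zero by simp
  qed
  thus ?thesis by blast
qed

text \<open>Nothing but \<open>v\<close> is reachable from \<open>v\<close>: it has no neighbour in \<open>W\<close>, and there are no loops.\<close>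

lemma isolated_vertex_num_components:
  assumes "finite W" "W \<noteq> {}" "v \<notin> W" "\<And>w. w \<in> W \<Longrightarrow> {v, w} \<notin> E"
  shows "num_components E (insert v W) > 1"
proof -
  let ?R = "induced_adj E (insert v W)"
  obtain w where w: "w \<in> W" using assms(2) by blast
  have "y = v" if "(v, y) \<in> ?R\<^sup>*" for y
    using that
  proof (induction rule: rtrancl_induct)
    case (step y z)
    have "{v, v} \<notin> E" using edgeD by blast
    thus ?case using step assms(4) by (auto simp: induced_adj_def)
  qed simp
  hence "?R\<^sup>* `` {v} \<noteq> ?R\<^sup>* `` {w}" using w assms(3) by blast
  thus ?thesis using w assms(1)
    by (intro num_components_gt_1[of _ "?R\<^sup>* `` {v}" _ "?R\<^sup>* `` {w}"]) (auto simp: components_iff)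
qed

text \<open>The candidate for \<open>W\<close> is the support of \<open>\<omega>\<close>. It has to be replaced in two situations: by any single vertex
  if \<open>\<omega> = 0\<close>, and by \<open>W \<union> {v}\<close> if \<open>W\<close> is connected and some vertex \<open>v\<close> outside \<open>W\<close> has no
  neighbour in \<open>W\<close>.\<close>

lemma resonance_subset:
  "resonance_variety A \<gg> s \<theta> \<subseteq>
    (\<Union>W\<in>{W. W \<subseteq> V \<and> num_components E W = 1}. P_set V E \<gg> s \<theta> W) \<union>
    (\<Union>W\<in>{W. W \<subseteq> V \<and> num_components E W > 1}. S_set V E \<gg> W)" (is "_ \<subseteq> ?P \<union> ?S")
proof
  fix t assume t: "t \<in> resonance_variety A \<gg> s \<theta>"
  obtain \<omega> where \<omega>: "\<And>v. v \<in> V \<Longrightarrow> \<omega> v \<in> vectors \<gg>" and t_eq: "t = tuple_sum \<gg> \<omega>"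
    using resonance_is_tuple[OF t] by blast
  have flat: "bracket \<gg> (\<omega> v) (\<omega> w) = 0" if "{v, w} \<in> E" for v w
    using t that resonance_iff[of \<omega>] \<omega> unfolding t_eq by blast
  obtain u where u: "cocycle \<omega> u" "\<nexists>x. \<forall>v\<in>V. u v = \<theta> (\<omega> v) x"
    using t resonance_iff[of \<omega>] \<omega> unfolding t_eq by blast
  define W where "W = {v \<in> V. \<omega> v \<noteq> 0}"
  have W: "W \<subseteq> V" "finite W" using finite_V by (auto simp: W_def)
  have off: "\<omega> v = 0" if "v \<in> V - W" for v using that by (auto simp: W_def)
  have nz: "\<omega> v \<noteq> 0" if "(v, w) \<in> induced_adj E W" for v w
    using that by (auto simp: W_def induced_adj_def)
  show "t \<in> ?P \<union> ?S"
  proof (cases "W = {}")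
    case True
    obtain v where v: "v \<in> V" using u(2) by blast
    have "C = {v}" if "C \<in> components E {v}" for C
      using component_nonempty[OF that] component_subset[OF that] by auto
    hence "components E {v} \<subseteq> {{v}}" by blast
    moreover have "components E {v} \<noteq> {}" using in_component[of v "{v}" E] by auto
    ultimately have "components E {v} = {{v}}" by (metis subset_singletonD)
    hence "num_components E {v} = 1" by (simp add: num_components_def)
    moreover have "t \<in> P_set V E \<gg> s \<theta> {v}"
    proof -
      have "\<not> surj (\<theta> 0)" using nonzero_module action_zero by (metis surjD)
      hence "endo_det s (\<theta> 0) = 0" using det_action_iff[OF g.closed(1)] by blast
      moreover have "\<omega> w = 0" if "w \<in> V" for w using True that by (auto simp: W_def)
      ultimately show ?thesis unfolding P_set_def tuple_tensor_def t_eq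
        using v g.closed(1) by (intro imageI) auto
    qed
    ultimately show ?thesis using v by blast
  next
    case False
    show ?thesis
    proof (cases "num_components E W > 1")
      case True
      have "t \<in> S_set V E \<gg> W" unfolding t_eq by (rule tuple_in_S[OF flat \<omega> nz W(1) off])
      thus ?thesis using True W(1) by blast
    next
      case not_several: False
      obtain w0 where w0: "w0 \<in> W" using False by blast
      have "components E W \<noteq> {}" using in_component[OF w0] by blast
      hence "num_components E W \<noteq> 0"
        using finite_components[OF W(2)] by (simp add: num_components_def)
      hence one: "num_components E W = 1" using not_several by linarith
      have comp: "components E W = {W}" by (rule one_component[OF one])
      show ?thesis
      proof (cases "\<exists>v\<in>V - W. \<forall>w\<in>W. {v, w} \<notin> E")
        case True
        then obtain v where v: "v \<in> V - W" "\<And>w. w \<in> W \<Longrightarrow> {v, w} \<notin> E" by blast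
        have several: "num_components E (insert v W) > 1"
          by (rule isolated_vertex_num_components[OF W(2) False]) (use v in auto)
        have nz': "\<omega> x \<noteq> 0" if xy: "(x, y) \<in> induced_adj E (insert v W)" for x y
        proof -
          have "{v, v} \<notin> E" using edgeD by blast
          hence "x \<noteq> v" using xy v(2) by (auto simp: induced_adj_def)
          thus ?thesis using xy by (auto simp: W_def induced_adj_def)
        qed
        have "t \<in> S_set V E \<gg> (insert v W)"
          unfolding t_eq
        proof (rule tuple_in_S[OF flat \<omega> nz'])
          show "insert v W \<subseteq> V" using v(1) W(1) by blast
        next
          fix x assume "x \<in> V - insert v W"
          thus "\<omega> x = 0" using off by blast
        qed
        moreover have "insert v W \<in> {W. W \<subseteq> V \<and> num_components E W > 1}"
          using several v(1) W(1) by simp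
        ultimately show ?thesis by (intro UnI2 UN_I)
      next
        case all_adjacent: False
        have multiple: "\<exists>c. \<omega> v = scale \<gg> c (\<omega> w)" if "v \<in> W" "w \<in> W" for v w
        proof -
          have "W \<in> components E W" using comp by simp
          then obtain x where "W = (induced_adj E W)\<^sup>* `` {x}" by (auto simp: components_iff)
          hence "(x, v) \<in> (induced_adj E W)\<^sup>*" "(x, w) \<in> (induced_adj E W)\<^sup>*" using that by blast+
          hence wv: "(w, v) \<in> (induced_adj E W)\<^sup>*"
            using symD[OF sym_reachable] rtrancl_trans by metis
          have "\<omega> v \<in> gv.span {\<omega> w}" by (rule reachable_collinear[OF flat \<omega> nz wv])
          thus ?thesis by (auto simp: gv.span_singleton)
        qed
        have mem: "\<omega> w0 \<in> vectors \<gg>" using \<omega> w0 W(1) by blast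
        have "endo_det s (\<theta> (\<omega> w0)) = 0"
        proof (rule ccontr)
          assume "endo_det s (\<theta> (\<omega> w0)) \<noteq> 0"
          hence inj0: "inj (\<theta> (\<omega> w0))" using det_action_iff inj_action_iff mem by blast
          have inj: "inj (\<theta> (\<omega> w))" if w: "w \<in> W" for w
          proof -
            have mem_w: "\<omega> w \<in> vectors \<gg>" using \<omega> w W(1) by blast
            obtain c where c: "\<omega> w0 = scale \<gg> c (\<omega> w)" using multiple[OF w0 w] by blast
            show ?thesis
            proof (rule injI)
              fix a b assume "\<theta> (\<omega> w) a = \<theta> (\<omega> w) b"
              hence "\<theta> (\<omega> w0) a = \<theta> (\<omega> w0) b" unfolding c using mem_w by (simp add: action_simps(5))
              thus "a = b" using inj0 by (rule injD[rotated])
            qed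
          qed
          have "\<exists>x. \<forall>v\<in>V. u v = \<theta> (\<omega> v) x"
            by (rule cocycle_coboundary_if_invertible[OF flat \<omega> W(1) comp off _ inj u(1)])
               (use all_adjacent in auto)
          thus False using u(2) by blast
        qed
        moreover have "\<exists>c. \<forall>v\<in>W. \<omega> v = scale \<gg> (c v) (\<omega> w0)" using multiple[OF _ w0] by metis
        ultimately have "t \<in> P_set V E \<gg> s \<theta> W"
          unfolding P_set_def tuple_tensor_def t_eq using mem off by blast
        thus ?thesis using one W(1) by blast
      qed
    qed
  qed
qed

theorem resonance_variety_eq:
  "resonance_variety A \<gg> s \<theta> =
    (\<Union>W\<in>{W. W \<subseteq> V \<and> num_components E W = 1}. P_set V E \<gg> s \<theta> W) \<union>
    (\<Union>W\<in>{W. W \<subseteq> V \<and> num_components E W > 1}. S_set V E \<gg> W)"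
  using resonance_subset P_subset S_subset by blast

end

theorem theorem6p3:
  fixes \<gg> :: "(complex^2^2) lie_algebra"
    and V :: "'v set" and E :: "'v set set"
    and s :: "complex \<Rightarrow> 'u::ab_group_add \<Rightarrow> 'u"
    and \<theta> :: "complex^2^2 \<Rightarrow> 'u \<Rightarrow> 'u"
  assumes "\<gg> = sl2 \<or> \<gg> = sol2"
    and "finite V" and "simplicial_graph V E"
    and "vector_space s"
    and "\<exists>B. finite B \<and> Modules.module.span s B = (UNIV :: 'u set)"
    and "\<exists>u :: 'u. u \<noteq> 0"
    and "lie_module \<gg> s \<theta>"
  shows "resonance_variety (raag_algebra V E) \<gg> s \<theta> =
    (\<Union>W\<in>{W. W \<subseteq> V \<and> num_components E W = 1}. P_set V E \<gg> s \<theta> W) \<union>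
    (\<Union>W\<in>{W. W \<subseteq> V \<and> num_components E W > 1}. S_set V E \<gg> W)"
proof -
  note g = sl2_sol2_simps[OF assms(1)]
  interpret rank_one_raag_module V E \<gg> s \<theta>
  proof (intro rank_one_raag_module.intro raag_module.intro raag_graph.intro
      raag_module_axioms.intro rank_one_raag_module_axioms.intro)
    fix x y assume "x \<in> vectors \<gg>" "y \<in> vectors \<gg>" "x \<noteq> 0" "bracket \<gg> x y = 0"
    thus "\<exists>c. y = scale \<gg> c x" using sl2_commuting[of x y] g by simp
  next
    show "bracket \<gg> x y = - bracket \<gg> y x" for x y by (simp add: g)
  qed (use assms complex_subspace_sl2_sol2[OF assms(1)] bracket_linear_sl2_sol2[OF assms(1)] in simp_all)
  show ?thesis by (rule resonance_variety_eq)
qed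

end
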